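(* Let $k=\mathbb{F}_q$ and let $A$ be a finite $k$-algebra, say $A=S\oplus J(A)$ where $S=\prod_{i=1}^r S_i^{\alpha_i}$ is a semisimple subalgebra, $S_i=M_{n_i}(\mathbb{F}_{q^{m_i}})$ for each $i$, the $S_i$ are pairwise non-isomorphic and the $\alpha_i$ are positive integers. Let $f(A,i):=m_i^{-1}n_i^{-2}\log_q(\alpha_i m_i)$, let $f(A):=\max_i f(A,i)$, and let $\mu(A)$ be the minimal length of an unrefinable chain of $S$-subbimodules of $J(A)$. Then $$-2.33<d(A)-f(A)<\mu(A)+3.42.$$
   Context: A finite algebra over $k=\mathbb{F}_q$ is an associative, unital, finite-dimensional $k$-algebra; $J(A)$ is its Jacobson radical, and by the Wedderburn–Malcev theorem $A=S\oplus J(A)$ as vector spaces for some semisimple subalgebra $S$. Subalgebras contain the identity, so the identity is automatically included in what is generated: $d(A)$ is the minimal number of generators of $A$ as a unital $k$-algebra (in particular $d(k)=0$). An unrefinable chain of $S$-subbimodules of $J(A)$ is a chain $0=H_0<H_1<\dots<H_\mu=J(A)$ of $S$-subbimodules that admits no proper refinement; its length is $\mu$ (so $\mu(A)=0$ if $J(A)=0$). *)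

theory Defs
  imports Complex_Main "HOL-Algebra.Subrings" "HOL-Algebra.Module"
begin

text \<open>
  The locale \<open>algebra\<close> of the library is about commutative algebras only, so we introduce
  associative unital algebras here, on the same record type.
\<close>

locale assoc_algebra = module K A + ring A for K (structure) and A (structure) +
  assumes smult_mult_left: "\<lbrakk>a \<in> carrier K; x \<in> carrier A; y \<in> carrier A\<rbrakk>
      \<Longrightarrow> (a \<odot>\<^bsub>A\<^esub> x) \<otimes>\<^bsub>A\<^esub> y = a \<odot>\<^bsub>A\<^esub> (x \<otimes>\<^bsub>A\<^esub> y)"
    and smult_mult_right: "\<lbrakk>a \<in> carrier K; x \<in> carrier A; y \<in> carrier A\<rbrakk>
      \<Longrightarrow> x \<otimes>\<^bsub>A\<^esub> (a \<odot>\<^bsub>A\<^esub> y) = a \<odot>\<^bsub>A\<^esub> (x \<otimes>\<^bsub>A\<^esub> y)"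

locale finite_algebra = assoc_algebra K A + field K for K (structure) and A (structure) +
  assumes finite_scalars: "finite (carrier K)"
    and finite_spanning: "\<exists>B \<subseteq> carrier A. finite B \<and>
      (\<forall>x \<in> carrier A. \<exists>c \<in> B \<rightarrow> carrier K. x = (\<Oplus>\<^bsub>A\<^esub> b \<in> B. c b \<odot>\<^bsub>A\<^esub> b))"

definition alg_iso ::
    "('k, 'r) ring_scheme \<Rightarrow> ('k, 'a, 's) module_scheme \<Rightarrow> ('k, 'b, 't) module_scheme \<Rightarrow> ('a \<Rightarrow> 'b) set"
  where "alg_iso K A B = {h \<in> ring_iso A B.
    \<forall>a \<in> carrier K. \<forall>x \<in> carrier A. h (a \<odot>\<^bsub>A\<^esub> x) = a \<odot>\<^bsub>B\<^esub> h x}"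

definition alg_isomorphic ::
    "('k, 'r) ring_scheme \<Rightarrow> ('k, 'a, 's) module_scheme \<Rightarrow> ('k, 'b, 't) module_scheme \<Rightarrow> bool"
  where "alg_isomorphic K A B \<longleftrightarrow> alg_iso K A B \<noteq> {}"

text \<open>\<open>matrix_alg n L\<close> is the algebra of \<open>n \<times> n\<close> matrices over \<open>L\<close>, with rows and columns
  indexed by \<open>{..<n}\<close> and entries undefined outside that range.\<close>

definition matrix_alg :: "nat \<Rightarrow> ('k, 'l, 's) module_scheme \<Rightarrow> ('k, nat \<times> nat \<Rightarrow> 'l) module"
  where "matrix_alg n L =
    \<lparr>carrier = ({..<n} \<times> {..<n}) \<rightarrow>\<^sub>E carrier L,
     monoid.mult = (\<lambda>M N. \<lambda>(i, j) \<in> {..<n} \<times> {..<n}. \<Oplus>\<^bsub>L\<^esub> l \<in> {..<n}. M (i, l) \<otimes>\<^bsub>L\<^esub> N (l, j)),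
     one = (\<lambda>(i, j) \<in> {..<n} \<times> {..<n}. if i = j then \<one>\<^bsub>L\<^esub> else \<zero>\<^bsub>L\<^esub>),
     zero = (\<lambda>p \<in> {..<n} \<times> {..<n}. \<zero>\<^bsub>L\<^esub>),
     add = (\<lambda>M N. \<lambda>p \<in> {..<n} \<times> {..<n}. M p \<oplus>\<^bsub>L\<^esub> N p),
     smult = (\<lambda>a M. \<lambda>p \<in> {..<n} \<times> {..<n}. a \<odot>\<^bsub>L\<^esub> M p)\<rparr>"

definition product_alg :: "'i set \<Rightarrow> ('i \<Rightarrow> ('k, 'a, 's) module_scheme) \<Rightarrow> ('k, 'i \<Rightarrow> 'a) module"
  where "product_alg I A =
    \<lparr>carrier = (\<Pi>\<^sub>E i\<in>I. carrier (A i)),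
     monoid.mult = (\<lambda>x y. \<lambda>i\<in>I. x i \<otimes>\<^bsub>A i\<^esub> y i),
     one = (\<lambda>i\<in>I. \<one>\<^bsub>A i\<^esub>),
     zero = (\<lambda>i\<in>I. \<zero>\<^bsub>A i\<^esub>),
     add = (\<lambda>x y. \<lambda>i\<in>I. x i \<oplus>\<^bsub>A i\<^esub> y i),
     smult = (\<lambda>a x. \<lambda>i\<in>I. a \<odot>\<^bsub>A i\<^esub> x i)\<rparr>"

definition unital_subalgebra ::
    "('k, 'r) ring_scheme \<Rightarrow> 'a set \<Rightarrow> ('k, 'a, 's) module_scheme \<Rightarrow> bool"
  where "unital_subalgebra K B A \<longleftrightarrow>
    subring B A \<and> (\<forall>a \<in> carrier K. \<forall>x \<in> B. a \<odot>\<^bsub>A\<^esub> x \<in> B)"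

definition generated_subalgebra ::
    "('k, 'r) ring_scheme \<Rightarrow> ('k, 'a, 's) module_scheme \<Rightarrow> 'a set \<Rightarrow> 'a set"
  where "generated_subalgebra K A G = \<Inter>{B. unital_subalgebra K B A \<and> G \<subseteq> B}"

definition min_generators :: "('k, 'r) ring_scheme \<Rightarrow> ('k, 'a, 's) module_scheme \<Rightarrow> nat"
  where "min_generators K A = (LEAST d. \<exists>G \<subseteq> carrier A.
    finite G \<and> card G = d \<and> generated_subalgebra K A G = carrier A)"

text \<open>The library's \<open>ideal\<close> and \<open>maximalideal\<close> are two-sided, whereas the Jacobson radical of a
  noncommutative ring is the intersection of its maximal left ideals.\<close>

definition left_ideal :: "'a set \<Rightarrow> ('a, 'r) ring_scheme \<Rightarrow> bool"
  where "left_ideal I R \<longleftrightarrow> additive_subgroup I R \<and> (\<forall>a \<in> carrier R. \<forall>x \<in> I. a \<otimes>\<^bsub>R\<^esub> x \<in> I)"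

definition maximal_left_ideal :: "'a set \<Rightarrow> ('a, 'r) ring_scheme \<Rightarrow> bool"
  where "maximal_left_ideal I R \<longleftrightarrow> left_ideal I R \<and> I \<noteq> carrier R \<and>
    (\<forall>I'. left_ideal I' R \<and> I \<subseteq> I' \<longrightarrow> I' = I \<or> I' = carrier R)"

definition jacobson_radical :: "('a, 'r) ring_scheme \<Rightarrow> 'a set"
  where "jacobson_radical R = carrier R \<inter> \<Inter>{I. maximal_left_ideal I R}"

text \<open>If \<open>S\<close> is a unital subalgebra of a \<open>K\<close>-algebra \<open>A\<close>, then it contains \<open>a \<odot> \<one>\<close> for every scalar
  \<open>a\<close>, so the subbimodules below are automatically \<open>K\<close>-subspaces.\<close>

definition subbimodule :: "('a, 'r) ring_scheme \<Rightarrow> 'a set \<Rightarrow> 'a set \<Rightarrow> 'a set \<Rightarrow> bool"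
  where "subbimodule A S M H \<longleftrightarrow> additive_subgroup H A \<and> H \<subseteq> M \<and>
    (\<forall>s \<in> S. \<forall>x \<in> H. s \<otimes>\<^bsub>A\<^esub> x \<in> H \<and> x \<otimes>\<^bsub>A\<^esub> s \<in> H)"

definition bimodule_chain ::
    "('a, 'r) ring_scheme \<Rightarrow> 'a set \<Rightarrow> 'a set \<Rightarrow> nat \<Rightarrow> (nat \<Rightarrow> 'a set) \<Rightarrow> bool"
  where "bimodule_chain A S M l H \<longleftrightarrow> H 0 = {\<zero>\<^bsub>A\<^esub>} \<and> H l = M \<and>
    (\<forall>i \<le> l. subbimodule A S M (H i)) \<and> (\<forall>i < l. H i \<subset> H (Suc i))"

text \<open>A chain refines another one if all terms of the latter occur among those of the former.\<close>

definition unrefinable_chain ::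
    "('a, 'r) ring_scheme \<Rightarrow> 'a set \<Rightarrow> 'a set \<Rightarrow> nat \<Rightarrow> (nat \<Rightarrow> 'a set) \<Rightarrow> bool"
  where "unrefinable_chain A S M l H \<longleftrightarrow> bimodule_chain A S M l H \<and>
    (\<nexists>l' H'. bimodule_chain A S M l' H' \<and> H ` {..l} \<subset> H' ` {..l'})"

definition min_chain_length :: "('a, 'r) ring_scheme \<Rightarrow> 'a set \<Rightarrow> nat"
  where "min_chain_length A S =
    (LEAST l. \<exists>H. unrefinable_chain A S (jacobson_radical A) l H)"

definition f_component :: "nat \<Rightarrow> nat \<Rightarrow> nat \<Rightarrow> nat \<Rightarrow> real"
  where "f_component q \<alpha> m n = log (real q) (real \<alpha> * real m) / (real m * (real n)\<^sup>2)"

end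

theory Submission
  imports Defs "HOL-Algebra.Multiplicative_Group"
begin

text \<open>
  Lower bound: a generating set with \<open>d\<close> elements gives each of the \<open>\<alpha>\<^sub>i\<close> copies of \<open>S\<^sub>i\<close> a
  \<open>d\<close>-tuple of coordinates, and these tuples are distinct, so \<open>\<alpha>\<^sub>i \<le> |S\<^sub>i|\<^sup>d\<close>. Since \<open>m < q\<^sup>m\<close>, this
  gives \<open>f(A) < d(A) + 1\<close>.

  Upper bound: a matrix algebra over a finite field with primitive element \<open>\<theta>\<close> is generated, even as
  a ring, by \<open>\<theta> E\<^sub>0\<^sub>0\<close> and a cyclic permutation matrix. An automorphism fixing these two matrices is
  trivial, so if \<open>d\<close> further generators distinguish the copies of each \<open>S\<^sub>i\<close>, then the
  kernels of the projections onto the simple factors are pairwise distinct, and the Chinese remainder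
  theorem shows that \<open>d + 2\<close> elements generate \<open>S\<close>. There is room for this as soon as
  \<open>\<alpha>\<^sub>i \<le> |S\<^sub>i|\<^sup>d\<close>, in particular for \<open>d = \<lceil>f(A)\<rceil>\<close>. Adding one element for each step of an unrefinable
  chain yields \<open>d(A) < f(A) + 3 + \<mu>(A)\<close>.
\<close>

section \<open>Matrix algebras\<close>

lemma (in abelian_monoid) finsum_swap:
  assumes "finite I" "finite J" "\<And>i j. \<lbrakk>i \<in> I; j \<in> J\<rbrakk> \<Longrightarrow> f i j \<in> carrier G"
  shows "(\<Oplus>i\<in>I. \<Oplus>j\<in>J. f i j) = (\<Oplus>j\<in>J. \<Oplus>i\<in>I. f i j)"
  using assms(1,3)
proof (induction I)
  case (insert i I)
  then have "(\<lambda>j. f i j) \<in> J \<rightarrow> carrier G" "(\<lambda>j. \<Oplus>i\<in>I. f i j) \<in> J \<rightarrow> carrier G"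
    by auto
  with insert show ?case
    by (simp add: finsum_addf Pi_def cong: finsum_cong)
qed simp

locale matrix_ring = ring L for L :: "('k, 'l, 's) module_scheme" (structure) +
  fixes n :: nat
begin

abbreviation "Mat \<equiv> matrix_alg n L"

abbreviation "idx \<equiv> {..<n} \<times> {..<n}"

lemma mat_carrier: "carrier Mat = idx \<rightarrow>\<^sub>E carrier L"
  by (simp add: matrix_alg_def)

lemma mat_entry [simp]: "\<lbrakk>M \<in> carrier Mat; i < n; j < n\<rbrakk> \<Longrightarrow> M (i, j) \<in> carrier L"
  by (auto simp: mat_carrier)

lemma mat_eqI:
  assumes "M \<in> carrier Mat" "N \<in> carrier Mat" "\<And>i j. \<lbrakk>i < n; j < n\<rbrakk> \<Longrightarrow> M (i, j) = N (i, j)"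
  shows "M = N"
  using assms(1,2) unfolding mat_carrier by (rule PiE_ext) (use assms(3) in auto)

lemma mat_add: "\<lbrakk>i < n; j < n\<rbrakk> \<Longrightarrow> (M \<oplus>\<^bsub>Mat\<^esub> N) (i, j) = M (i, j) \<oplus> N (i, j)"
  and mat_mult: "\<lbrakk>i < n; j < n\<rbrakk> \<Longrightarrow> (M \<otimes>\<^bsub>Mat\<^esub> N) (i, j) = (\<Oplus>l\<in>{..<n}. M (i, l) \<otimes> N (l, j))"
  and mat_zero: "\<lbrakk>i < n; j < n\<rbrakk> \<Longrightarrow> \<zero>\<^bsub>Mat\<^esub> (i, j) = \<zero>"
  and mat_one: "\<lbrakk>i < n; j < n\<rbrakk> \<Longrightarrow> \<one>\<^bsub>Mat\<^esub> (i, j) = (if i = j then \<one> else \<zero>)"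
  by (simp_all add: matrix_alg_def)

lemma mat_closed [simp]:
  shows "\<zero>\<^bsub>Mat\<^esub> \<in> carrier Mat" "\<one>\<^bsub>Mat\<^esub> \<in> carrier Mat"
    and "\<lbrakk>M \<in> carrier Mat; N \<in> carrier Mat\<rbrakk> \<Longrightarrow> M \<oplus>\<^bsub>Mat\<^esub> N \<in> carrier Mat"
    and "\<lbrakk>M \<in> carrier Mat; N \<in> carrier Mat\<rbrakk> \<Longrightarrow> M \<otimes>\<^bsub>Mat\<^esub> N \<in> carrier Mat"
  by (auto simp: matrix_alg_def PiE_iff split: prod.splits intro!: finsum_closed)

lemma mat_ring: "ring Mat"
proof (rule ringI)
  show "abelian_group Mat"
  proof (rule abelian_groupI)
    fix M assume M: "M \<in> carrier Mat"
    have "(\<lambda>p\<in>idx. \<ominus> M p) \<in> carrier Mat"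
      using M by (auto simp: mat_carrier)
    moreover from this have "(\<lambda>p\<in>idx. \<ominus> M p) \<oplus>\<^bsub>Mat\<^esub> M = \<zero>\<^bsub>Mat\<^esub>"
      using M by (intro mat_eqI) (simp_all add: mat_add mat_zero l_neg)
    ultimately show "\<exists>N\<in>carrier Mat. N \<oplus>\<^bsub>Mat\<^esub> M = \<zero>\<^bsub>Mat\<^esub>"
      by blast
  qed (auto intro!: mat_eqI simp: mat_add mat_zero a_ac)
  show "monoid Mat"
  proof (rule monoidI)
    fix M N P assume MNP: "M \<in> carrier Mat" "N \<in> carrier Mat" "P \<in> carrier Mat"
    show "M \<otimes>\<^bsub>Mat\<^esub> N \<otimes>\<^bsub>Mat\<^esub> P = M \<otimes>\<^bsub>Mat\<^esub> (N \<otimes>\<^bsub>Mat\<^esub> P)"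
    proof (rule mat_eqI)
      fix i j assume ij: "i < n" "j < n"
      \<comment> \<open>Both products expand to the double sum of
        \<open>M (i, k) N (k, l) P (l, j)\<close>; only the order of summation differs.\<close>
      have "(\<Oplus>l\<in>{..<n}. (\<Oplus>k\<in>{..<n}. M (i, k) \<otimes> N (k, l)) \<otimes> P (l, j))
          = (\<Oplus>l\<in>{..<n}. \<Oplus>k\<in>{..<n}. M (i, k) \<otimes> (N (k, l) \<otimes> P (l, j)))"
        using MNP ij by (intro finsum_cong') (auto simp: finsum_ldistr Pi_iff m_assoc intro!: finsum_closed finsum_cong')
      also have "\<dots> = (\<Oplus>k\<in>{..<n}. \<Oplus>l\<in>{..<n}. M (i, k) \<otimes> (N (k, l) \<otimes> P (l, j)))"
        using MNP ij by (intro finsum_swap) auto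
      also have "\<dots> = (\<Oplus>k\<in>{..<n}. M (i, k) \<otimes> (\<Oplus>l\<in>{..<n}. N (k, l) \<otimes> P (l, j)))"
        using MNP ij by (intro finsum_cong') (auto simp: finsum_rdistr Pi_iff intro!: finsum_closed finsum_cong')
      finally show "(M \<otimes>\<^bsub>Mat\<^esub> N \<otimes>\<^bsub>Mat\<^esub> P) (i, j) = (M \<otimes>\<^bsub>Mat\<^esub> (N \<otimes>\<^bsub>Mat\<^esub> P)) (i, j)"
        using MNP ij by (simp add: mat_mult Pi_iff cong: finsum_cong)
    qed (use MNP in auto)
  next
    fix M assume M: "M \<in> carrier Mat"
    show "\<one>\<^bsub>Mat\<^esub> \<otimes>\<^bsub>Mat\<^esub> M = M"
    proof (rule mat_eqI)
      fix i j assume ij: "i < n" "j < n"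
      \<comment> \<open>The test is written with the fixed index on the left, \<open>i = l\<close>,
        because \<open>finsum_singleton\<close> collapses sums of exactly this shape.\<close>
      have "(\<Oplus>l\<in>{..<n}. \<one>\<^bsub>Mat\<^esub> (i, l) \<otimes> M (l, j)) = (\<Oplus>l\<in>{..<n}. if i = l then M (l, j) else \<zero>)"
        using M ij by (intro finsum_cong') (auto simp: mat_one)
      also have "\<dots> = M (i, j)"
        using M ij by (intro finsum_singleton) auto
      finally show "(\<one>\<^bsub>Mat\<^esub> \<otimes>\<^bsub>Mat\<^esub> M) (i, j) = M (i, j)"
        using ij by (simp add: mat_mult)
    qed (use M in auto)
    show "M \<otimes>\<^bsub>Mat\<^esub> \<one>\<^bsub>Mat\<^esub> = M"
    proof (rule mat_eqI)
      fix i j assume ij: "i < n" "j < n"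
      have "(\<Oplus>l\<in>{..<n}. M (i, l) \<otimes> \<one>\<^bsub>Mat\<^esub> (l, j)) = (\<Oplus>l\<in>{..<n}. if j = l then M (i, l) else \<zero>)"
        using M ij by (intro finsum_cong') (auto simp: mat_one)
      also have "\<dots> = M (i, j)"
        using M ij by (intro finsum_singleton) auto
      finally show "(M \<otimes>\<^bsub>Mat\<^esub> \<one>\<^bsub>Mat\<^esub>) (i, j) = M (i, j)"
        using ij by (simp add: mat_mult)
    qed (use M in auto)
  qed auto
next
  fix M N P assume MNP: "M \<in> carrier Mat" "N \<in> carrier Mat" "P \<in> carrier Mat"
  show "(M \<oplus>\<^bsub>Mat\<^esub> N) \<otimes>\<^bsub>Mat\<^esub> P = M \<otimes>\<^bsub>Mat\<^esub> P \<oplus>\<^bsub>Mat\<^esub> N \<otimes>\<^bsub>Mat\<^esub> P"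
    using MNP by (intro mat_eqI)
      (simp_all add: mat_mult mat_add l_distr finsum_addf Pi_iff cong: finsum_cong)
  show "P \<otimes>\<^bsub>Mat\<^esub> (M \<oplus>\<^bsub>Mat\<^esub> N) = P \<otimes>\<^bsub>Mat\<^esub> M \<oplus>\<^bsub>Mat\<^esub> P \<otimes>\<^bsub>Mat\<^esub> N"
    using MNP by (intro mat_eqI)
      (simp_all add: mat_mult mat_add r_distr finsum_addf Pi_iff cong: finsum_cong)
qed

section \<open>Elementary matrices and the cyclic permutation matrix\<close>

definition elem_mat :: "nat \<Rightarrow> nat \<Rightarrow> 'l \<Rightarrow> nat \<times> nat \<Rightarrow> 'l"
  where "elem_mat a b x = (\<lambda>p\<in>idx. if p = (a, b) then x else \<zero>)"

text \<open>The permutation matrix of an n-cycle on the indices. For \<open>n = 1\<close> it is the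
  identity, so 1 x 1 matrices need no separate treatment.\<close>

definition cyclic_mat :: "nat \<times> nat \<Rightarrow> 'l"
  where "cyclic_mat = (\<lambda>(i, j)\<in>idx. if j = Suc i mod n then \<one> else \<zero>)"

lemma elem_mat_entry: "\<lbrakk>i < n; j < n\<rbrakk> \<Longrightarrow> elem_mat a b x (i, j) = (if i = a \<and> j = b then x else \<zero>)"
  by (simp add: elem_mat_def)

lemma elem_mat_closed [simp]: "x \<in> carrier L \<Longrightarrow> elem_mat a b x \<in> carrier Mat"
  by (auto simp: elem_mat_def mat_carrier)

lemma cyclic_mat_closed [simp]: "cyclic_mat \<in> carrier Mat"
  by (auto simp: cyclic_mat_def mat_carrier)

lemma cyclic_mat_entry: "\<lbrakk>i < n; j < n\<rbrakk> \<Longrightarrow> cyclic_mat (i, j) = (if j = Suc i mod n then \<one> else \<zero>)"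
  by (simp add: cyclic_mat_def)

lemma elem_mat_mult_entry:
  assumes "x \<in> carrier L" "M \<in> carrier Mat" "b < n" "i < n" "j < n"
  shows "(elem_mat a b x \<otimes>\<^bsub>Mat\<^esub> M) (i, j) = (if i = a then x \<otimes> M (b, j) else \<zero>)"
proof -
  have "(\<Oplus>l\<in>{..<n}. elem_mat a b x (i, l) \<otimes> M (l, j))
      = (\<Oplus>l\<in>{..<n}. if b = l then (if i = a then x \<otimes> M (l, j) else \<zero>) else \<zero>)"
    using assms by (intro finsum_cong') (auto simp: elem_mat_entry)
  also have "\<dots> = (if i = a then x \<otimes> M (b, j) else \<zero>)"
    using assms by (intro finsum_singleton) auto
  finally show ?thesis
    using assms by (simp add: mat_mult)
qed

lemma mult_elem_mat_entry:
  assumes "x \<in> carrier L" "M \<in> carrier Mat" "a < n" "i < n" "j < n"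
  shows "(M \<otimes>\<^bsub>Mat\<^esub> elem_mat a b x) (i, j) = (if j = b then M (i, a) \<otimes> x else \<zero>)"
proof -
  have "(\<Oplus>l\<in>{..<n}. M (i, l) \<otimes> elem_mat a b x (l, j))
      = (\<Oplus>l\<in>{..<n}. if a = l then (if j = b then M (i, l) \<otimes> x else \<zero>) else \<zero>)"
    using assms by (intro finsum_cong') (auto simp: elem_mat_entry)
  also have "\<dots> = (if j = b then M (i, a) \<otimes> x else \<zero>)"
    using assms by (intro finsum_singleton) auto
  finally show ?thesis
    using assms by (simp add: mat_mult)
qed

text \<open>Sandwiching isolates the single entry \<open>M (b, c)\<close> and moves it to an
  arbitrary position; the simplicity of matrix rings rests on this.\<close>

lemma elem_mat_mult:
  assumes "x \<in> carrier L" "M \<in> carrier Mat" "y \<in> carrier L" "b < n" "c < n"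
  shows "elem_mat a b x \<otimes>\<^bsub>Mat\<^esub> M \<otimes>\<^bsub>Mat\<^esub> elem_mat c d y = elem_mat a d (x \<otimes> M (b, c) \<otimes> y)"
  using assms
  by (intro mat_eqI) (auto simp: mult_elem_mat_entry elem_mat_mult_entry elem_mat_entry)

lemma elem_mat_mult_elem_mat:
  assumes "x \<in> carrier L" "y \<in> carrier L" "b < n"
  shows "elem_mat a b x \<otimes>\<^bsub>Mat\<^esub> elem_mat b d y = elem_mat a d (x \<otimes> y)"
  using assms by (intro mat_eqI) (auto simp: elem_mat_mult_entry elem_mat_entry)

text \<open>Right multiplication by \<open>cyclic_mat\<close> advances the column index; left
  multiplication, treated next, lowers the row index. Together they reach every position from (0,
  0).\<close>

lemma elem_mat_cyclic_mat:
  assumes "x \<in> carrier L" "b < n"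
  shows "elem_mat a b x \<otimes>\<^bsub>Mat\<^esub> cyclic_mat = elem_mat a (Suc b mod n) x"
  using assms
  by (intro mat_eqI) (auto simp: elem_mat_mult_entry elem_mat_entry cyclic_mat_entry)

lemma cyclic_mat_elem_mat:
  assumes "x \<in> carrier L" "a < n"
  shows "cyclic_mat \<otimes>\<^bsub>Mat\<^esub> elem_mat (Suc a mod n) b x = elem_mat a b x"
proof -
  \<comment> \<open>Successor modulo \<open>n\<close> is injective on \<open>{..<n}\<close>, so the
    entry formula of the product singles out row \<open>a\<close>.\<close>
  have "i = a" if "Suc i mod n = Suc a mod n" "i < n" for i
    using that assms(2) by (auto simp: mod_Suc split: if_splits)
  with assms show ?thesis
    by (intro mat_eqI) (auto simp: mult_elem_mat_entry elem_mat_entry cyclic_mat_entry)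
qed

text \<open>\<open>H\<close> is only asked to contain zero and to be closed under addition, so that
  the result serves both ideals and subrings.\<close>

lemma elem_mats_span:
  assumes "\<zero>\<^bsub>Mat\<^esub> \<in> H" "\<And>M N. \<lbrakk>M \<in> H; N \<in> H\<rbrakk> \<Longrightarrow> M \<oplus>\<^bsub>Mat\<^esub> N \<in> H"
    and "\<And>a b x. \<lbrakk>a < n; b < n; x \<in> carrier L\<rbrakk> \<Longrightarrow> elem_mat a b x \<in> H"
  shows "carrier Mat \<subseteq> H"
proof -
  \<comment> \<open>Induction on a finite set \<open>F\<close> containing the support of
    \<open>M\<close>: the entry at a new position \<open>p\<close> is cleared and then added back as
    an elementary matrix.\<close>
  have "M \<in> H" if "finite F" "F \<subseteq> idx" "M \<in> carrier Mat" "\<And>p. p \<in> idx - F \<Longrightarrow> M p = \<zero>" for F M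
    using that
  proof (induction F arbitrary: M)
    case empty
    then have "M = \<zero>\<^bsub>Mat\<^esub>"
      by (intro mat_eqI) (auto simp: mat_zero)
    with assms(1) show ?case
      by simp
  next
    case (insert p F)
    obtain a b where p: "p = (a, b)" "a < n" "b < n"
      using insert.prems(1) by auto
    define N where "N = M(p := \<zero>)"
    have N: "N \<in> carrier Mat"
      using insert.prems p unfolding N_def mat_carrier by (auto simp: PiE_iff extensional_def)
    have "N \<in> H"
      using insert.prems by (intro insert.IH N) (auto simp: N_def)
    moreover have "M = N \<oplus>\<^bsub>Mat\<^esub> elem_mat a b (M p)"
      using insert.prems p N by (intro mat_eqI) (auto simp: mat_add elem_mat_entry N_def)
    ultimately show ?case
      using assms(2,3) insert.prems p by (metis mat_entry)
  qed
  from this[of idx] show ?thesis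
    by auto
qed

end

section \<open>Simplicity of matrix rings over a field\<close>

locale matrix_field = field L for L :: "('k, 'l, 's) module_scheme" (structure) +
  fixes n :: nat

sublocale matrix_field \<subseteq> matrix_ring L n ..

context matrix_field
begin

text \<open>A nonzero matrix in the ideal has a nonzero, hence invertible, entry. Sandwiching it
  between suitable elementary matrices puts every \<open>elem_mat a d x\<close> into the ideal, and
  these span.\<close>

lemma mat_simple:
  assumes "ideal I Mat"
  shows "I = {\<zero>\<^bsub>Mat\<^esub>} \<or> I = carrier Mat"
proof (cases "I \<subseteq> {\<zero>\<^bsub>Mat\<^esub>}")
  case False
  interpret I: ideal I Mat by fact
  from False obtain M where M: "M \<in> I" "M \<noteq> \<zero>\<^bsub>Mat\<^esub>"
    by auto
  have "M \<in> carrier Mat"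
    using M(1) by (rule I.a_Hcarr)
  with M(2) obtain b c where bc: "b < n" "c < n" "M (b, c) \<noteq> \<zero>"
    using mat_eqI[of M "\<zero>\<^bsub>Mat\<^esub>"] by (auto simp: mat_zero)
  then have unit: "M (b, c) \<in> Units L"
    using \<open>M \<in> carrier Mat\<close> by (simp add: field_Units)
  have "elem_mat a d x \<in> I" if "x \<in> carrier L" for a d x
  proof -
    have "elem_mat a d x
        = elem_mat a b (x \<otimes> inv (M (b, c))) \<otimes>\<^bsub>Mat\<^esub> M \<otimes>\<^bsub>Mat\<^esub> elem_mat c d \<one>"
      using that unit bc \<open>M \<in> carrier Mat\<close> by (simp add: elem_mat_mult m_assoc)
    moreover have "\<dots> \<in> I"
      using that unit M(1) by (intro I.I_l_closed I.I_r_closed) auto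
    ultimately show ?thesis
      by simp
  qed
  then have "carrier Mat \<subseteq> I"
    by (intro elem_mats_span) auto
  then show ?thesis
    using I.a_subset by auto
qed (use additive_subgroup.zero_closed[OF ideal.axioms(1)[OF assms]] in auto)

lemma mat_one_neq_zero: "n \<ge> 1 \<Longrightarrow> \<one>\<^bsub>Mat\<^esub> \<noteq> \<zero>\<^bsub>Mat\<^esub>"
  using mat_one[of 0 0] mat_zero[of 0 0] by auto

end

section \<open>Two generators for a matrix ring over a finite field\<close>

text \<open>The multiplicative group is cyclic. Exponents are kept positive because the products of
  \<open>elem_mat 0 0 \<theta>\<close> with itself only yield positive powers of \<theta> in the
  corner.\<close>

lemma (in field) finite_field_powers:
  assumes "finite (carrier R)"
  obtains \<theta> where "\<theta> \<in> carrier R" "carrier R - {\<zero>} \<subseteq> range (\<lambda>k. \<theta> [^] Suc k)"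
proof -
  obtain \<theta> where "\<theta> \<in> carrier (mult_of R)" "carrier (mult_of R) = {\<theta> [^] k |k::nat. k \<in> UNIV}"
    using finite_field_mult_group_has_gen[OF assms] by blast
  then have \<theta>: "\<theta> \<in> carrier R - {\<zero>}" "carrier R - {\<zero>} = range (\<lambda>k::nat. \<theta> [^] k)"
    by (auto simp: full_SetCompr_eq)
  have "inv \<theta> \<in> carrier R - {\<zero>}"
    using \<theta>(1) field_Units Units_inv_Units by auto
  \<comment> \<open>The inverse of \<theta> is itself a power \<theta>^k, so \<theta>^(k+1) = 1 and
    any exponent l may be replaced by l + k + 1.\<close>
  then obtain k where k: "inv \<theta> = \<theta> [^] (k::nat)"
    using \<theta>(2) by auto
  have "x \<in> range (\<lambda>k. \<theta> [^] Suc k)" if x: "x \<in> carrier R - {\<zero>}" for x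
  proof -
    obtain l where l: "x = \<theta> [^] (l::nat)"
      using x \<theta>(2) by auto
    have "\<theta> [^] Suc (l + k) = \<theta> [^] l \<otimes> (\<theta> [^] k \<otimes> \<theta>)"
      using \<theta>(1) by (simp add: nat_pow_mult[symmetric] m_assoc)
    also have "\<dots> = x"
      using \<theta>(1) l x by (simp add: k[symmetric] field_Units)
    finally show ?thesis
      by (metis rangeI)
  qed
  with \<theta>(1) show ?thesis
    by (intro that) auto
qed

context matrix_field
begin

text \<open>Powers of \<open>elem_mat 0 0 \<theta>\<close> fill the corner, right multiplication by
  \<open>cyclic_mat\<close> spreads it over row 0, and left multiplication spreads row 0 over all
  rows. \<open>H\<close> is a mere subring, since the result will be applied to the fixed points of
  a ring automorphism that is not known to be linear over the scalars.\<close>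

lemma mat_two_generated:
  assumes "subring H Mat" "n \<ge> 1"
    and \<theta>: "\<theta> \<in> carrier L" "carrier L - {\<zero>} \<subseteq> range (\<lambda>k. \<theta> [^] Suc k)"
    and "elem_mat 0 0 \<theta> \<in> H" "cyclic_mat \<in> H"
  shows "H = carrier Mat"
proof -
  note H = subringE[OF assms(1)]
  have zero_eq: "elem_mat a b \<zero> = \<zero>\<^bsub>Mat\<^esub>" for a b
    by (intro mat_eqI) (auto simp: elem_mat_entry mat_zero)
  have pow: "elem_mat 0 0 (\<theta> [^] Suc k) \<in> H" for k
  proof (induction k)
    case (Suc k)
    have "elem_mat 0 0 (\<theta> [^] Suc k) \<otimes>\<^bsub>Mat\<^esub> elem_mat 0 0 \<theta> = elem_mat 0 0 (\<theta> [^] Suc (Suc k))"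
      using \<theta>(1) assms(2) by (subst elem_mat_mult_elem_mat) auto
    with H(6)[OF Suc assms(5)] show ?case
      by simp
  qed (use assms \<theta>(1) in simp)
  have corner: "elem_mat 0 0 x \<in> H" if x: "x \<in> carrier L" for x
  proof (cases "x = \<zero>")
    case False
    then obtain k where "x = \<theta> [^] Suc k"
      using x \<theta>(2) by blast
    with pow show ?thesis
      by simp
  qed (use H zero_eq in simp)
  have row: "elem_mat 0 b x \<in> H" if "x \<in> carrier L" "b < n" for b x
    using that(2)
  proof (induction b)
    case (Suc b)
    then have "elem_mat 0 b x \<otimes>\<^bsub>Mat\<^esub> cyclic_mat = elem_mat 0 (Suc b) x"
      using that(1) by (simp add: elem_mat_cyclic_mat)
    with Suc H(6) assms(6) show ?case
      by (metis Suc_lessD)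
  qed (use corner that in simp)
  have "elem_mat a b x \<in> H" if "a < n" "x \<in> carrier L" "b < n" for a b x
  proof -
    \<comment> \<open>Descending induction on the row: the wrap-around of the cycle carries row 0 to
      row \<open>n - 1\<close>, and each further left multiplication lowers the row by one.\<close>
    have "a \<le> n - 1"
      using that by simp
    then show ?thesis
    proof (induction a rule: inc_induct)
      case base
      have "cyclic_mat \<otimes>\<^bsub>Mat\<^esub> elem_mat 0 b x = elem_mat (n - 1) b x"
        using cyclic_mat_elem_mat[OF that(2), of "n - 1" b] assms(2) by simp
      with H(6)[OF assms(6) row] that show ?case
        by metis
    next
      case (step a)
      have "cyclic_mat \<otimes>\<^bsub>Mat\<^esub> elem_mat (Suc a) b x = elem_mat a b x"
        using cyclic_mat_elem_mat[OF that(2), of a b] step by simp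
      with H(6)[OF assms(6) step.IH] show ?case
        by metis
    qed
  qed
  then have "carrier Mat \<subseteq> H"
    using H(2,7) by (intro elem_mats_span) auto
  with H(1) show ?thesis
    by auto
qed

end

section \<open>Surjections onto products of simple rings\<close>

lemma (in ring) additive_subgroup_intro:
  assumes "H \<subseteq> carrier R" "\<zero> \<in> H" "\<And>x. x \<in> H \<Longrightarrow> \<ominus> x \<in> H"
    and "\<And>x y. \<lbrakk>x \<in> H; y \<in> H\<rbrakk> \<Longrightarrow> x \<oplus> y \<in> H"
  shows "additive_subgroup H R"
  using add.subgroupI[OF assms(1) _ assms(3,4)] assms(2) unfolding additive_subgroup_def by auto

text \<open>For simple targets, non-inclusion of kernels already gives comaximality: the kernel of
  \<open>h p\<close> maps onto a nonzero ideal of \<open>T p'\<close>, which therefore contains the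
  identity. The rest is the usual interpolation.\<close>

lemma (in ring) chinese_remainder_simple:
  fixes T :: "'i \<Rightarrow> ('c, 's) ring_scheme"
  assumes "finite I"
    and hom: "\<And>p. p \<in> I \<Longrightarrow> ring_hom_ring R (T p) (h p)"
    and surj: "\<And>p. p \<in> I \<Longrightarrow> h p ` carrier R = carrier (T p)"
    and simple: "\<And>p J. \<lbrakk>p \<in> I; ideal J (T p)\<rbrakk> \<Longrightarrow> J = {\<zero>\<^bsub>T p\<^esub>} \<or> J = carrier (T p)"
    and sep: "\<And>p p'. \<lbrakk>p \<in> I; p' \<in> I; p \<noteq> p'\<rbrakk>
      \<Longrightarrow> \<exists>x\<in>carrier R. h p x = \<zero>\<^bsub>T p\<^esub> \<and> h p' x \<noteq> \<zero>\<^bsub>T p'\<^esub>"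
    and y: "\<And>p. p \<in> I \<Longrightarrow> y p \<in> carrier (T p)"
  shows "\<exists>x\<in>carrier R. \<forall>p\<in>I. h p x = y p"
proof -
  have unit: "\<exists>x\<in>carrier R. h p x = \<zero>\<^bsub>T p\<^esub> \<and> h p' x = \<one>\<^bsub>T p'\<^esub>"
    if pp': "p \<in> I" "p' \<in> I" "p \<noteq> p'" for p p'
  proof -
    interpret h: ring_hom_ring R "T p" "h p" by (rule hom) fact
    interpret h': ring_hom_ring R "T p'" "h p'" by (rule hom) fact
    \<comment> \<open>The image of an ideal under the surjection \<open>h p'\<close> is an
      ideal.\<close>
    define J where "J = h p' ` {x \<in> carrier R. h p x = \<zero>\<^bsub>T p\<^esub>}"
    have "ideal J (T p')"
    proof (rule idealI)
      show "subgroup J (add_monoid (T p'))"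
      proof (rule additive_subgroup.a_subgroup, rule h'.S.additive_subgroup_intro)
        show "\<zero>\<^bsub>T p'\<^esub> \<in> J"
          unfolding J_def by (rule image_eqI[of _ _ \<zero>]) auto
      next
        fix u assume "u \<in> J"
        then obtain x where "x \<in> carrier R" "h p x = \<zero>\<^bsub>T p\<^esub>" "u = h p' x"
          by (auto simp: J_def)
        then show "\<ominus>\<^bsub>T p'\<^esub> u \<in> J"
          unfolding J_def by (intro image_eqI[of _ _ "\<ominus> x"]) auto
      next
        fix u v assume "u \<in> J" "v \<in> J"
        then obtain x z where "x \<in> carrier R" "h p x = \<zero>\<^bsub>T p\<^esub>" "u = h p' x"
            "z \<in> carrier R" "h p z = \<zero>\<^bsub>T p\<^esub>" "v = h p' z"
          by (auto simp: J_def)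
        then show "u \<oplus>\<^bsub>T p'\<^esub> v \<in> J"
          unfolding J_def by (intro image_eqI[of _ _ "x \<oplus> z"]) auto
      qed (auto simp: J_def)
    next
      fix u v assume "u \<in> J" "v \<in> carrier (T p')"
      then obtain x z where xz: "x \<in> carrier R" "h p x = \<zero>\<^bsub>T p\<^esub>" "u = h p' x"
          "z \<in> carrier R" "v = h p' z"
        unfolding J_def surj[OF pp'(2), symmetric] by blast
      then show "u \<otimes>\<^bsub>T p'\<^esub> v \<in> J"
        unfolding J_def by (intro image_eqI[of _ _ "x \<otimes> z"]) auto
      from xz show "v \<otimes>\<^bsub>T p'\<^esub> u \<in> J"
        unfolding J_def by (intro image_eqI[of _ _ "z \<otimes> x"]) auto
    qed (rule h'.S.ring_axioms)
    moreover have "J \<noteq> {\<zero>\<^bsub>T p'\<^esub>}"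
      using sep[OF pp'] by (auto simp: J_def)
    ultimately have "J = carrier (T p')"
      using simple pp'(2) by blast
    then have "\<one>\<^bsub>T p'\<^esub> \<in> J"
      by simp
    then show ?thesis
      by (auto simp: J_def)
  qed
  \<comment> \<open>Multiplying the elements from \<open>unit\<close> yields a common
    \<open>e\<close> that is one at \<open>p\<close> and zero on \<open>F\<close>; only the images
    of \<open>e\<close> are idempotent, \<open>e\<close> itself need not be.\<close>
  have idem: "\<exists>e\<in>carrier R. h p e = \<one>\<^bsub>T p\<^esub> \<and> (\<forall>p'\<in>F. h p' e = \<zero>\<^bsub>T p'\<^esub>)"
    if "finite F" "F \<subseteq> I" "p \<in> I" "p \<notin> F" for p F
    using that
  proof (induction F)
    case empty
    interpret h: ring_hom_ring R "T p" "h p" by (rule hom) fact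
    show ?case
      by (intro bexI[of _ \<one>]) auto
  next
    case (insert p' F)
    interpret h: ring_hom_ring R "T p" "h p" by (rule hom) fact
    obtain e where e: "e \<in> carrier R" "h p e = \<one>\<^bsub>T p\<^esub>" "\<forall>p'\<in>F. h p' e = \<zero>\<^bsub>T p'\<^esub>"
      using insert by auto
    obtain x where x: "x \<in> carrier R" "h p' x = \<zero>\<^bsub>T p'\<^esub>" "h p x = \<one>\<^bsub>T p\<^esub>"
      using unit[of p' p] insert.prems by auto
    have "h q (x \<otimes> e) = \<zero>\<^bsub>T q\<^esub>" if "q \<in> insert p' F" for q
    proof -
      interpret g: ring_hom_ring R "T q" "h q" using that insert.prems by (intro hom) auto
      have "h q x = \<zero>\<^bsub>T q\<^esub> \<or> h q e = \<zero>\<^bsub>T q\<^esub>"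
        using that e x by auto
      with e x show ?thesis
        by auto
    qed
    with e x show ?case
      by (intro bexI[of _ "x \<otimes> e"]) auto
  qed
  have "\<exists>x\<in>carrier R. \<forall>p\<in>F. h p x = y p" if "finite F" "F \<subseteq> I" for F
    using that
  proof (induction F)
    case (insert p F)
    then obtain x where x: "x \<in> carrier R" "\<forall>p\<in>F. h p x = y p"
      by auto
    have "p \<in> I"
      using insert by auto
    obtain e where e: "e \<in> carrier R" "h p e = \<one>\<^bsub>T p\<^esub>" "\<forall>p'\<in>F. h p' e = \<zero>\<^bsub>T p'\<^esub>"
      using idem[of F p] insert by auto
    obtain z where z: "z \<in> carrier R" "h p z = y p"
      using y[OF \<open>p \<in> I\<close>] surj[OF \<open>p \<in> I\<close>] by (metis imageE)
    \<comment> \<open>The correction \<open>e \<otimes> (z \<ominus> x)\<close> turns the value of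
      \<open>x\<close> at \<open>p\<close> into that of \<open>z\<close> and vanishes at all indices
      of \<open>F\<close>.\<close>
    have "h q (e \<otimes> (z \<ominus> x) \<oplus> x) = y q" if q: "q \<in> insert p F" for q
    proof -
      have "q \<in> I"
        using q insert.prems by auto
      interpret g: ring_hom_ring R "T q" "h q" by (rule hom) fact
      have "h q (e \<otimes> (z \<ominus> x) \<oplus> x) = h q e \<otimes>\<^bsub>T q\<^esub> (h q z \<ominus>\<^bsub>T q\<^esub> h q x) \<oplus>\<^bsub>T q\<^esub> h q x"
        using e x z by (simp add: a_minus_def)
      also have "\<dots> = y q"
      proof (cases "q = p")
        case True
        then have "h q e = \<one>\<^bsub>T q\<^esub>" "h q z = y q"
          using e z by auto
        then show ?thesis
          using y[OF \<open>q \<in> I\<close>] g.hom_closed[OF x(1)]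
          by (simp add: a_minus_def g.S.a_assoc g.S.l_neg)
      next
        case False
        then have "h q e = \<zero>\<^bsub>T q\<^esub>" "h q x = y q"
          using q e x by auto
        then show ?thesis
          using y[OF \<open>q \<in> I\<close>] g.hom_closed[OF z(1)] by (simp add: a_minus_def)
      qed
      finally show ?thesis .
    qed
    with e x z show ?case
      by (intro bexI[of _ "e \<otimes> (z \<ominus> x) \<oplus> x"]) auto
  qed auto
  with assms(1) show ?thesis
    by blast
qed

text \<open>\<open>h'\<close> factors through \<open>h\<close>, and the induced map is injective
  because its source is simple. This turns a failure of separation of two coordinates into an
  isomorphism between them.\<close>

lemma (in ring) iso_of_kernel_subset:
  fixes T :: "('c, 's) ring_scheme" and T' :: "('d, 't) ring_scheme"
  assumes h: "ring_hom_ring R T h" "h ` carrier R = carrier T"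
    and h': "ring_hom_ring R T' h'" "h' ` carrier R = carrier T'"
    and simple: "\<And>J. ideal J T \<Longrightarrow> J = {\<zero>\<^bsub>T\<^esub>} \<or> J = carrier T"
    and "\<one>\<^bsub>T'\<^esub> \<noteq> \<zero>\<^bsub>T'\<^esub>"
    and ker: "\<And>x. \<lbrakk>x \<in> carrier R; h x = \<zero>\<^bsub>T\<^esub>\<rbrakk> \<Longrightarrow> h' x = \<zero>\<^bsub>T'\<^esub>"
  shows "\<exists>\<psi>\<in>ring_iso T T'. \<forall>x\<in>carrier R. \<psi> (h x) = h' x"
proof -
  interpret h: ring_hom_ring R T h by fact
  interpret h': ring_hom_ring R T' h' by fact
  have wd: "h' x = h' y" if "x \<in> carrier R" "y \<in> carrier R" "h x = h y" for x y
  proof -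
    have "h (x \<ominus> y) = \<zero>\<^bsub>T\<^esub>"
      using that by (simp add: a_minus_def h.S.r_neg)
    then have "h' x \<ominus>\<^bsub>T'\<^esub> h' y = \<zero>\<^bsub>T'\<^esub>"
      using ker[of "x \<ominus> y"] that by (simp add: a_minus_def)
    then show ?thesis
      using that by simp
  qed
  \<comment> \<open>An arbitrary preimage under \<open>h\<close> is chosen; \<open>wd\<close> makes
    the value independent of the choice.\<close>
  define \<psi> where "\<psi> y = h' (SOME x. x \<in> carrier R \<and> h x = y)" for y
  have \<psi>: "\<psi> (h x) = h' x" if "x \<in> carrier R" for x
  proof -
    have "(SOME z. z \<in> carrier R \<and> h z = h x) \<in> carrier R \<and> h (SOME z. z \<in> carrier R \<and> h z = h x) = h x"
      by (rule someI[of _ x]) (simp add: that)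
    then show ?thesis
      unfolding \<psi>_def using that by (intro wd) auto
  qed
  have lift: "\<exists>x\<in>carrier R. y = h x" if "y \<in> carrier T" for y
    using that h(2) by blast
  have hom: "\<psi> \<in> ring_hom T T'"
  proof (rule ring_hom_memI)
    show "\<psi> \<one>\<^bsub>T\<^esub> = \<one>\<^bsub>T'\<^esub>"
      using \<psi>[of \<one>] by simp
  next
    fix y assume "y \<in> carrier T"
    with lift \<psi> show "\<psi> y \<in> carrier T'"
      by fastforce
    fix z assume "z \<in> carrier T"
    obtain x x' where x: "x \<in> carrier R" "y = h x" "x' \<in> carrier R" "z = h x'"
      using lift[OF \<open>y \<in> carrier T\<close>] lift[OF \<open>z \<in> carrier T\<close>] by blast
    show "\<psi> (y \<otimes>\<^bsub>T\<^esub> z) = \<psi> y \<otimes>\<^bsub>T'\<^esub> \<psi> z"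
      using x \<psi>[of "x \<otimes> x'"] \<psi> by simp
    show "\<psi> (y \<oplus>\<^bsub>T\<^esub> z) = \<psi> y \<oplus>\<^bsub>T'\<^esub> \<psi> z"
      using x \<psi>[of "x \<oplus> x'"] \<psi> by simp
  qed
  interpret \<psi>: ring_hom_ring T T' \<psi>
    by (rule ring_hom_ringI2[OF h.S.ring_axioms h'.S.ring_axioms hom])
  have "a_kernel T T' \<psi> \<noteq> carrier T"
  proof
    assume "a_kernel T T' \<psi> = carrier T"
    then have "\<one>\<^bsub>T\<^esub> \<in> a_kernel T T' \<psi>"
      by simp
    then have "\<psi> \<one>\<^bsub>T\<^esub> = \<zero>\<^bsub>T'\<^esub>"
      by (simp only: a_kernel_def' mem_Collect_eq)
    then show False
      using \<open>\<one>\<^bsub>T'\<^esub> \<noteq> \<zero>\<^bsub>T'\<^esub>\<close> \<psi>.hom_one by simp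
  qed
  then have "a_kernel T T' \<psi> = {\<zero>\<^bsub>T\<^esub>}"
    using simple \<psi>.kernel_is_ideal by blast
  then have "inj_on \<psi> (carrier T)"
    by (rule \<psi>.trivial_ker_imp_inj)
  moreover have "\<psi> ` carrier T = carrier T'"
    unfolding h(2)[symmetric] h'(2)[symmetric] using \<psi> by (auto simp: image_image)
  ultimately have "\<psi> \<in> ring_iso T T'"
    using hom by (auto simp: ring_iso_def bij_betw_def)
  with \<psi> show ?thesis
    by blast
qed

section \<open>The Jacobson radical\<close>

text \<open>The set in question is the annihilator of the nonzero class of \<open>a\<close> in the
  simple left module \<open>R / I\<close>, so its quotient is isomorphic to that module. The proof
  expresses this with elements.\<close>

lemma (in ring) maximal_left_ideal_colon:
  assumes I: "maximal_left_ideal I R" and a: "a \<in> carrier R" "a \<notin> I"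
  shows "maximal_left_ideal {x \<in> carrier R. x \<otimes> a \<in> I} R"
proof -
  let ?C = "{x \<in> carrier R. x \<otimes> a \<in> I}"
  interpret I: additive_subgroup I R
    using I by (simp add: maximal_left_ideal_def left_ideal_def)
  have I_mult: "b \<otimes> x \<in> I" if "b \<in> carrier R" "x \<in> I" for b x
    using I that by (simp add: maximal_left_ideal_def left_ideal_def)
  have I_minus: "\<ominus> x \<in> I" if "x \<in> I" for x
    using that I_mult[of "\<ominus> \<one>" x] I.a_Hcarr by (simp add: l_minus)
  have "left_ideal ?C R"
    unfolding left_ideal_def
    using a I_mult by (auto intro!: additive_subgroup_intro simp: l_minus I_minus l_distr m_assoc)
  moreover have "?C \<noteq> carrier R"
    using a by (metis (mono_tags, lifting) l_one mem_Collect_eq one_closed)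
  moreover have "N = carrier R" if N: "left_ideal N R" "?C \<subseteq> N" "N \<noteq> ?C" for N
  proof -
    interpret N: additive_subgroup N R
      using N by (simp add: left_ideal_def)
    have N_mult: "b \<otimes> x \<in> N" if "b \<in> carrier R" "x \<in> N" for b x
      using N that by (simp add: left_ideal_def)
    obtain y where y: "y \<in> N" "y \<otimes> a \<notin> I"
      using N(2,3) N.a_Hcarr by blast
    then have yc: "y \<in> carrier R"
      using N.a_Hcarr by blast
    \<comment> \<open>\<open>I'\<close> is the left ideal \<open>I + R y a\<close>. It contains
      \<open>y \<otimes> a\<close>, which lies outside \<open>I\<close>, so maximality makes it the
      whole ring.\<close>
    define I' where "I' = {u \<oplus> b \<otimes> (y \<otimes> a) | u b. u \<in> I \<and> b \<in> carrier R}"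
    have I'I: "u \<oplus> b \<otimes> (y \<otimes> a) \<in> I'" if "u \<in> I" "b \<in> carrier R" for u b
      using that by (auto simp: I'_def)
    have "left_ideal I' R"
      unfolding left_ideal_def
    proof (intro conjI ballI additive_subgroup_intro)
      show "I' \<subseteq> carrier R"
        using a yc I.a_Hcarr by (auto simp: I'_def)
      show "\<zero> \<in> I'"
        using I'I[of \<zero> \<zero>] a yc by simp
    next
      fix v assume "v \<in> I'"
      then obtain u b where v: "v = u \<oplus> b \<otimes> (y \<otimes> a)" "u \<in> I" "b \<in> carrier R"
        by (auto simp: I'_def)
      show "\<ominus> v \<in> I'"
        using I'I[of "\<ominus> u" "\<ominus> b"] v a yc I.a_Hcarr I_minus by (simp add: l_minus minus_add)
      fix c assume c: "c \<in> carrier R"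
      show "c \<otimes> v \<in> I'"
        using I'I[of "c \<otimes> u" "c \<otimes> b"] v a yc c I.a_Hcarr I_mult by (simp add: m_assoc r_distr)
    next
      fix v w assume "v \<in> I'" "w \<in> I'"
      then obtain u b u' b' where v: "v = u \<oplus> b \<otimes> (y \<otimes> a)" "u \<in> I" "b \<in> carrier R"
          "w = u' \<oplus> b' \<otimes> (y \<otimes> a)" "u' \<in> I" "b' \<in> carrier R"
        by (auto simp: I'_def)
      then show "v \<oplus> w \<in> I'"
        using I'I[of "u \<oplus> u'" "b \<oplus> b'"] a yc I.a_Hcarr by (simp add: l_distr a_ac)
    qed
    moreover have "I \<subseteq> I'"
      using I'I[of _ \<zero>] a yc I.a_Hcarr by fastforce
    moreover have "y \<otimes> a \<in> I'"
      using I'I[of \<zero> \<one>] a yc by simp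
    ultimately have "I' = carrier R"
      using I y(2) unfolding maximal_left_ideal_def by blast
    have "z \<in> N" if z: "z \<in> carrier R" for z
    proof -
      have "z \<otimes> a \<in> I'"
        using z a \<open>I' = carrier R\<close> by simp
      then obtain u b where ub: "z \<otimes> a = u \<oplus> b \<otimes> (y \<otimes> a)" "u \<in> I" "b \<in> carrier R"
        by (auto simp: I'_def)
      \<comment> \<open>Since \<open>z \<otimes> a\<close> lies in \<open>I + R y a\<close>,
        subtracting the right multiple \<open>b \<otimes> y\<close> moves \<open>z\<close> into the
        colon ideal, hence into \<open>N\<close>; as \<open>y\<close> is in \<open>N\<close>, so is
        \<open>z\<close>.\<close>
      have "(z \<ominus> b \<otimes> y) \<otimes> a = z \<otimes> a \<ominus> b \<otimes> (y \<otimes> a)"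
        using z a yc ub(3) by (simp add: a_minus_def l_distr l_minus m_assoc)
      also have "\<dots> = u"
        using a yc ub I.a_Hcarr by (simp add: a_minus_def a_assoc r_neg)
      finally have "z \<ominus> b \<otimes> y \<in> N"
        using N(2) ub z yc by auto
      then have "(z \<ominus> b \<otimes> y) \<oplus> b \<otimes> y \<in> N"
        using N_mult ub(3) y(1) by blast
      then show ?thesis
        using z ub(3) yc by (simp add: a_minus_def a_assoc l_neg)
    qed
    then show ?thesis
      using N.a_subset by blast
  qed
  ultimately show ?thesis
    unfolding maximal_left_ideal_def by blast
qed

text \<open>An intersection of left ideals is a left ideal. For right multiplication by
  \<open>a\<close>, membership of \<open>x \<otimes> a\<close> in a maximal left ideal
  \<open>I\<close> means membership of \<open>x\<close> in the colon ideal, which is again maximal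
  unless \<open>a\<close> is already in \<open>I\<close>.\<close>

lemma (in ring) jacobson_radical_ideal: "ideal (jacobson_radical R) R"
proof (rule idealI)
  have left: "left_ideal I R" if "maximal_left_ideal I R" for I
    using that by (simp add: maximal_left_ideal_def)
  have neg: "\<ominus> x \<in> I" if "left_ideal I R" "x \<in> I" for x I
  proof -
    have "\<ominus> \<one> \<otimes> x \<in> I" "x \<in> carrier R"
      using that additive_subgroup.a_Hcarr by (auto simp: left_ideal_def)
    then show ?thesis
      by (simp add: l_minus)
  qed
  show "subgroup (jacobson_radical R) (add_monoid R)"
  proof (intro additive_subgroup.a_subgroup additive_subgroup_intro)
    show "\<zero> \<in> jacobson_radical R"
      using left by (auto simp: jacobson_radical_def left_ideal_def additive_subgroup.zero_closed)
  next
    fix x y assume "x \<in> jacobson_radical R" "y \<in> jacobson_radical R"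
    with left show "x \<oplus> y \<in> jacobson_radical R"
      by (auto simp: jacobson_radical_def left_ideal_def additive_subgroup.a_closed)
  qed (use left neg in \<open>auto simp: jacobson_radical_def\<close>)
  fix x a assume x: "x \<in> jacobson_radical R" and a: "a \<in> carrier R"
  from x a left show "a \<otimes> x \<in> jacobson_radical R"
    by (auto simp: jacobson_radical_def left_ideal_def)
  have "x \<otimes> a \<in> I" if I: "maximal_left_ideal I R" for I
  proof (cases "a \<in> I")
    case True
    then show ?thesis
      using x a left[OF I] by (auto simp: jacobson_radical_def left_ideal_def)
  next
    case False
    with maximal_left_ideal_colon[OF I a] x show ?thesis
      by (auto simp: jacobson_radical_def)
  qed
  with x a show "x \<otimes> a \<in> jacobson_radical R"
    by (auto simp: jacobson_radical_def)
qed (rule ring_axioms)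

section \<open>Chains of subbimodules\<close>

lemma bimodule_chain_mono:
  assumes "bimodule_chain A S M l H" "i \<le> j" "j \<le> l"
  shows "H i \<subseteq> H j"
  using assms(2,3)
proof (induction j rule: dec_induct)
  case (step j)
  then have "H j \<subset> H (Suc j)"
    using assms(1) by (simp add: bimodule_chain_def)
  with step show ?case
    by simp
qed simp

lemma bimodule_chain_strict_mono:
  assumes "bimodule_chain A S M l H" "i < j" "j \<le> l"
  shows "H i \<subset> H j"
proof -
  have "H i \<subset> H (Suc i)"
    using assms by (simp add: bimodule_chain_def)
  moreover have "H (Suc i) \<subseteq> H j"
    using assms by (intro bimodule_chain_mono) auto
  ultimately show ?thesis
    by blast
qed

text \<open>This lets strict inclusions between the term sets of chains be decided by comparing
  lengths.\<close>

lemma card_bimodule_chain: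
  assumes "bimodule_chain A S M l H"
  shows "card (H ` {..l}) = Suc l"
proof -
  have "inj_on H {..l}"
  proof (rule linorder_inj_onI)
    fix i j assume "i < j" "i \<in> {..l}" "j \<in> {..l}"
    with bimodule_chain_strict_mono[OF assms, of i j] show "H i \<noteq> H j"
      by auto
  qed auto
  then show ?thesis
    by (simp add: card_image)
qed

text \<open>A chain of greatest length cannot be refined, and lengths are bounded because the terms
  are distinct subsets of a finite set. Thus the least length in \<open>min_chain_length\<close> is
  attained.\<close>

lemma unrefinable_chain_exists:
  assumes "finite M" "subbimodule A S M {\<zero>\<^bsub>A\<^esub>}" "subbimodule A S M M"
  shows "\<exists>l H. unrefinable_chain A S M l H"
proof -
  have bound: "l \<le> card (Pow M)" if "bimodule_chain A S M l H" for l H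
  proof -
    have "H ` {..l} \<subseteq> Pow M"
      using that by (auto simp: bimodule_chain_def subbimodule_def)
    then have "card (H ` {..l}) \<le> card (Pow M)"
      using assms(1) by (intro card_mono) auto
    then show ?thesis
      using card_bimodule_chain[OF that] by simp
  qed
  have "\<exists>l H. bimodule_chain A S M l H"
  proof (cases "M = {\<zero>\<^bsub>A\<^esub>}")
    case True
    then have "bimodule_chain A S M 0 (\<lambda>_. M)"
      using assms by (simp add: bimodule_chain_def)
    then show ?thesis
      by blast
  next
    case False
    moreover have "\<zero>\<^bsub>A\<^esub> \<in> M"
      using assms(2) by (auto simp: subbimodule_def)
    ultimately have "bimodule_chain A S M 1 (\<lambda>i. if i = 0 then {\<zero>\<^bsub>A\<^esub>} else M)"
      using assms by (auto simp: bimodule_chain_def)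
    then show ?thesis
      by blast
  qed
  then obtain l H where H: "bimodule_chain A S M l H"
    and max: "\<And>l' H'. bimodule_chain A S M l' H' \<Longrightarrow> l' \<le> l"
  proof -
    assume chain: "\<exists>l H. bimodule_chain A S M l H"
      and that: "\<And>l H. \<lbrakk>bimodule_chain A S M l H; \<And>l' H'. bimodule_chain A S M l' H' \<Longrightarrow> l' \<le> l\<rbrakk> \<Longrightarrow> thesis"
    let ?l = "GREATEST l. \<exists>H. bimodule_chain A S M l H"
    have "\<exists>H. bimodule_chain A S M ?l H"
      by (rule GreatestI_ex_nat[OF chain]) (use bound in blast)
    moreover have "l' \<le> ?l" if "bimodule_chain A S M l' H'" for l' H'
      by (rule Greatest_le_nat) (use bound that in blast)+
    ultimately show thesis
      using that by blast
  qed
  have "\<not> H ` {..l} \<subset> H' ` {..l'}" if "bimodule_chain A S M l' H'" for l' H'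
  proof
    assume "H ` {..l} \<subset> H' ` {..l'}"
    then have "card (H ` {..l}) < card (H' ` {..l'})"
      by (intro psubset_card_mono) auto
    with max[OF that] show False
      by (simp add: card_bimodule_chain[OF H] card_bimodule_chain[OF that])
  qed
  with H have "unrefinable_chain A S M l H"
    by (simp add: unrefinable_chain_def)
  then show ?thesis
    by blast
qed

lemma unrefinable_chain_step:
  assumes H: "unrefinable_chain A S M l H" and i: "i < l"
    and N: "subbimodule A S M N" "H i \<subset> N" "N \<subseteq> H (Suc i)"
  shows "N = H (Suc i)"
proof (rule ccontr)
  assume neq: "N \<noteq> H (Suc i)"
  \<comment> \<open>\<open>N\<close> is inserted as the term with index \<open>Suc i\<close> and all
    later terms are shifted by one, which would be a proper refinement.\<close>
  define H' where "H' = (\<lambda>j. if j \<le> i then H j else if j = Suc i then N else H (j - 1))"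
  have chain: "bimodule_chain A S M l H"
    using H by (simp add: unrefinable_chain_def)
  have "H' j \<subset> H' (Suc j)" if "j < Suc l" for j
  proof -
    consider "j < i" | "j = i" | "j = Suc i" | "j > Suc i"
      by linarith
    then show ?thesis
    proof cases
      case 3
      then show ?thesis
        using N(3) neq by (auto simp: H'_def)
    next
      case 4
      moreover from 4 have "H (j - 1) \<subset> H j"
        using that by (intro bimodule_chain_strict_mono[OF chain]) auto
      ultimately show ?thesis
        by (simp add: H'_def)
    qed (use chain N(2) i in \<open>simp_all add: H'_def bimodule_chain_def\<close>)
  qed
  moreover have "subbimodule A S M (H' j)" if "j \<le> Suc l" for j
    using chain that i N(1) by (simp add: H'_def bimodule_chain_def)
  moreover have "H' 0 = {\<zero>\<^bsub>A\<^esub>}" "H' (Suc l) = M"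
    using chain i by (simp_all add: H'_def bimodule_chain_def)
  ultimately have chain': "bimodule_chain A S M (Suc l) H'"
    by (simp add: bimodule_chain_def)
  have "H j \<in> H' ` {..Suc l}" if "j \<le> l" for j
  proof (cases "j \<le> i")
    case True
    then have "H j = H' j"
      by (simp add: H'_def)
    with that show ?thesis
      by auto
  next
    case False
    then have "H j = H' (Suc j)"
      by (simp add: H'_def)
    with that show ?thesis
      by auto
  qed
  then have "H ` {..l} \<subseteq> H' ` {..Suc l}"
    by auto
  moreover have "card (H ` {..l}) < card (H' ` {..Suc l})"
    by (simp only: card_bimodule_chain[OF chain] card_bimodule_chain[OF chain'])
  ultimately have "H ` {..l} \<subset> H' ` {..Suc l}"
    by auto
  with H chain' show False
    by (auto simp: unrefinable_chain_def)
qed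

section \<open>Unital subalgebras\<close>

context assoc_algebra
begin

lemma unital_subalgebra_carrier: "unital_subalgebra K (carrier A) A"
  by (simp add: unital_subalgebra_def carrier_is_subring)

lemma unital_subalgebra_Int:
  "\<lbrakk>unital_subalgebra K B A; unital_subalgebra K C A\<rbrakk> \<Longrightarrow> unital_subalgebra K (B \<inter> C) A"
  by (auto simp: unital_subalgebra_def intro: subring_inter)

lemma generated_subalgebra_eqI:
  assumes "G \<subseteq> carrier A" "\<And>B. \<lbrakk>unital_subalgebra K B A; G \<subseteq> B\<rbrakk> \<Longrightarrow> carrier A \<subseteq> B"
  shows "generated_subalgebra K A G = carrier A"
  unfolding generated_subalgebra_def
  using assms unital_subalgebra_carrier by (intro equalityI) auto

text \<open>Used with the Jacobson radical, to pass from a subalgebra of \<open>S\<close> to one of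
  \<open>A\<close>.\<close>

lemma unital_subalgebra_add_ideal:
  assumes D: "unital_subalgebra K D A" and J: "ideal J A"
  shows "unital_subalgebra K (D <+>\<^bsub>A\<^esub> J) A"
proof -
  interpret J: ideal J A by fact
  have sub: "subring D A" and sm: "\<And>a x. \<lbrakk>a \<in> carrier K; x \<in> D\<rbrakk> \<Longrightarrow> a \<odot>\<^bsub>A\<^esub> x \<in> D"
    using D by (auto simp: unital_subalgebra_def)
  note D' = subringE[OF sub]
  have Dc: "x \<in> carrier A" if "x \<in> D" for x
    using D'(1) that by blast
  note Jc = J.a_Hcarr
  have memI: "d \<oplus>\<^bsub>A\<^esub> x \<in> D <+>\<^bsub>A\<^esub> J" if "d \<in> D" "x \<in> J" for d x
    using that by (auto simp: set_add_def')
  have memE: "\<exists>d\<in>D. \<exists>x\<in>J. y = d \<oplus>\<^bsub>A\<^esub> x" if "y \<in> D <+>\<^bsub>A\<^esub> J" for y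
    using that by (auto simp: set_add_def')
  have "subring (D <+>\<^bsub>A\<^esub> J) A"
  proof (rule subringI)
    show "D <+>\<^bsub>A\<^esub> J \<subseteq> carrier A"
      using memE Dc Jc by fastforce
    show "\<one>\<^bsub>A\<^esub> \<in> D <+>\<^bsub>A\<^esub> J"
      using memI[of "\<one>\<^bsub>A\<^esub>" "\<zero>\<^bsub>A\<^esub>"] D' by simp
  next
    fix y assume "y \<in> D <+>\<^bsub>A\<^esub> J"
    then obtain d x where "d \<in> D" "x \<in> J" "y = d \<oplus>\<^bsub>A\<^esub> x"
      using memE by blast
    then show "\<ominus>\<^bsub>A\<^esub> y \<in> D <+>\<^bsub>A\<^esub> J"
      using memI[of "\<ominus>\<^bsub>A\<^esub> d" "\<ominus>\<^bsub>A\<^esub> x"] D' Dc Jc by (simp add: minus_add)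
  next
    fix y z assume "y \<in> D <+>\<^bsub>A\<^esub> J" "z \<in> D <+>\<^bsub>A\<^esub> J"
    then obtain d x e w where dx: "d \<in> D" "x \<in> J" "y = d \<oplus>\<^bsub>A\<^esub> x" "e \<in> D" "w \<in> J" "z = e \<oplus>\<^bsub>A\<^esub> w"
      using memE by meson
    then have c: "d \<in> carrier A" "x \<in> carrier A" "e \<in> carrier A" "w \<in> carrier A"
      using Dc Jc by auto
    have "y \<otimes>\<^bsub>A\<^esub> z = d \<otimes>\<^bsub>A\<^esub> e \<oplus>\<^bsub>A\<^esub> (d \<otimes>\<^bsub>A\<^esub> w \<oplus>\<^bsub>A\<^esub> x \<otimes>\<^bsub>A\<^esub> (e \<oplus>\<^bsub>A\<^esub> w))"
      using dx c by (simp add: l_distr r_distr a_ac)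
    moreover have "d \<otimes>\<^bsub>A\<^esub> w \<oplus>\<^bsub>A\<^esub> x \<otimes>\<^bsub>A\<^esub> (e \<oplus>\<^bsub>A\<^esub> w) \<in> J"
      using dx c by (intro J.a_closed J.I_l_closed J.I_r_closed) auto
    ultimately show "y \<otimes>\<^bsub>A\<^esub> z \<in> D <+>\<^bsub>A\<^esub> J"
      using memI D'(6) dx by auto
    have "y \<oplus>\<^bsub>A\<^esub> z = (d \<oplus>\<^bsub>A\<^esub> e) \<oplus>\<^bsub>A\<^esub> (x \<oplus>\<^bsub>A\<^esub> w)"
      using dx c by (simp add: a_ac)
    then show "y \<oplus>\<^bsub>A\<^esub> z \<in> D <+>\<^bsub>A\<^esub> J"
      using memI D'(7) dx J.a_closed by auto
  qed
  moreover have "a \<odot>\<^bsub>A\<^esub> y \<in> D <+>\<^bsub>A\<^esub> J" if a: "a \<in> carrier K" and y: "y \<in> D <+>\<^bsub>A\<^esub> J" for a y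
  proof -
    obtain d x where dx: "d \<in> D" "x \<in> J" "y = d \<oplus>\<^bsub>A\<^esub> x"
      using y memE by blast
    \<comment> \<open>A ring ideal is stable under scalars, because a scalar acts as multiplication
      by \<open>a \<odot> \<one>\<close>.\<close>
    have "a \<odot>\<^bsub>A\<^esub> x = (a \<odot>\<^bsub>A\<^esub> \<one>\<^bsub>A\<^esub>) \<otimes>\<^bsub>A\<^esub> x"
      using a Jc[OF dx(2)] by (simp add: smult_mult_left)
    also have "\<dots> \<in> J"
      using a dx by (intro J.I_l_closed) auto
    finally show ?thesis
      using memI[of "a \<odot>\<^bsub>A\<^esub> d" "a \<odot>\<^bsub>A\<^esub> x"] sm[OF a dx(1)] dx a Dc Jc by (simp add: smult_r_distr)
  qed
  ultimately show ?thesis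
    by (simp add: unital_subalgebra_def)
qed

end

lemma (in finite_algebra) finite_carrier: "finite (carrier A)"
proof -
  obtain B where B: "B \<subseteq> carrier A" "finite B"
    and span: "\<forall>x\<in>carrier A. \<exists>c\<in>B \<rightarrow> carrier K. x = (\<Oplus>\<^bsub>A\<^esub>b\<in>B. c b \<odot>\<^bsub>A\<^esub> b)"
    using finite_spanning by blast
  have "carrier A \<subseteq> (\<lambda>c. \<Oplus>\<^bsub>A\<^esub>b\<in>B. c b \<odot>\<^bsub>A\<^esub> b) ` (B \<rightarrow>\<^sub>E carrier K)"
  proof
    fix x assume "x \<in> carrier A"
    then obtain c where c: "c \<in> B \<rightarrow> carrier K" "x = (\<Oplus>\<^bsub>A\<^esub>b\<in>B. c b \<odot>\<^bsub>A\<^esub> b)"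
      using span by blast
    \<comment> \<open>Coefficient functions are restricted to \<open>B\<close> so that only finitely
      many remain.\<close>
    have "x = (\<Oplus>\<^bsub>A\<^esub>b\<in>B. restrict c B b \<odot>\<^bsub>A\<^esub> b)"
      unfolding c(2) using c(1) B(1) by (intro M.finsum_cong') (auto intro!: smult_closed)
    moreover have "restrict c B \<in> B \<rightarrow>\<^sub>E carrier K"
      using c(1) by auto
    ultimately show "x \<in> (\<lambda>c. \<Oplus>\<^bsub>A\<^esub>b\<in>B. c b \<odot>\<^bsub>A\<^esub> b) ` (B \<rightarrow>\<^sub>E carrier K)"
      by (rule image_eqI)
  qed
  moreover have "finite (B \<rightarrow>\<^sub>E carrier K)"
    using B(2) finite_scalars by (intro finite_PiE) auto
  ultimately show ?thesis
    by (meson finite_imageI finite_subset)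
qed

text \<open>One element of each difference \<open>H (Suc i) - H i\<close> of a shortest unrefinable
  chain is added to generators of \<open>S\<close>. A subalgebra containing them all absorbs the
  chain term by term.\<close>

lemma (in assoc_algebra) generators_along_chain:
  assumes finite_carrier: "finite (carrier A)" and S: "unital_subalgebra K S A"
    and decomp: "S <+>\<^bsub>A\<^esub> jacobson_radical A = carrier A"
    and G: "G \<subseteq> S" "finite G" "\<And>B. \<lbrakk>unital_subalgebra K B A; G \<subseteq> B\<rbrakk> \<Longrightarrow> S \<subseteq> B"
  shows "\<exists>G' \<subseteq> carrier A. finite G' \<and> generated_subalgebra K A G' = carrier A
    \<and> card G' \<le> card G + min_chain_length A S"
proof -
  let ?J = "jacobson_radical A"
  interpret J: ideal ?J A
    by (rule jacobson_radical_ideal)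
  have sub: "subring S A"
    using S by (simp add: unital_subalgebra_def)
  note S' = subringE[OF sub]
  have "subbimodule A S ?J {\<zero>\<^bsub>A\<^esub>}"
    using S'(1) zeroideal by (auto simp: subbimodule_def ideal_def)
  moreover have "subbimodule A S ?J ?J"
    using S'(1) J.additive_subgroup_axioms J.I_l_closed J.I_r_closed
    by (auto simp: subbimodule_def)
  moreover have "finite ?J"
    using finite_carrier J.a_subset by (rule rev_finite_subset)
  ultimately have "\<exists>l H. unrefinable_chain A S ?J l H"
    by (intro unrefinable_chain_exists)
  then have "\<exists>H. unrefinable_chain A S ?J (min_chain_length A S) H"
    unfolding min_chain_length_def by (rule LeastI_ex)
  then obtain l H where H: "unrefinable_chain A S ?J l H" and l: "l = min_chain_length A S"
    by blast
  have chain: "bimodule_chain A S ?J l H"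
    using H by (simp add: unrefinable_chain_def)
  have "\<exists>x. x \<in> H (Suc i) - H i" if "i < l" for i
    using that chain by (auto simp: bimodule_chain_def)
  then obtain x where x: "\<And>i. i < l \<Longrightarrow> x i \<in> H (Suc i) - H i"
    by metis
  have HJ: "H i \<subseteq> ?J" if "i \<le> l" for i
    using chain that by (simp add: bimodule_chain_def subbimodule_def)
  define G' where "G' = G \<union> x ` {..<l}"
  have "x i \<in> carrier A" if "i < l" for i
    using x[OF that] HJ[of "Suc i"] that J.a_subset by auto
  then have G'c: "G' \<subseteq> carrier A"
    using G(1) S'(1) by (auto simp: G'_def)
  have "carrier A \<subseteq> B" if B: "unital_subalgebra K B A" "G' \<subseteq> B" for B
  proof -
    have "subring B A"
      using B(1) by (simp add: unital_subalgebra_def)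
    note B' = subringE[OF this]
    have SB: "S \<subseteq> B"
      using G(3) B by (auto simp: G'_def)
    have "H i \<subseteq> B" if "i \<le> l" for i
      using that
    proof (induction i)
      case 0
      then show ?case
        using chain B'(2) by (simp add: bimodule_chain_def)
    next
      case (Suc i)
      have Hm: "subbimodule A S ?J (H (Suc i))"
        using chain Suc.prems by (simp add: bimodule_chain_def)
      interpret Hi: additive_subgroup "H (Suc i)" A
        using Hm by (simp add: subbimodule_def)
      have "additive_subgroup (H (Suc i) \<inter> B) A"
      proof (rule additive_subgroup_intro)
        fix y assume "y \<in> H (Suc i) \<inter> B"
        then show "\<ominus>\<^bsub>A\<^esub> y \<in> H (Suc i) \<inter> B"
          using Hi.a_inv_closed B'(5) by auto
      qed (use Hi.a_subset B' in auto)
      \<comment> \<open>As \<open>S\<close> lies in \<open>B\<close>, the intersection is stable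
        under \<open>S\<close> on both sides. It contains \<open>H i\<close> and also
        \<open>x i\<close>, so unrefinability leaves only \<open>H (Suc i)\<close>.\<close>
      then have N: "subbimodule A S ?J (H (Suc i) \<inter> B)"
        using Hm SB B'(6) by (auto simp: subbimodule_def)
      have "H i \<subset> H (Suc i)" "x i \<in> H (Suc i) - H i" "x i \<in> B"
        using chain x[of i] Suc.prems B(2) by (auto simp: bimodule_chain_def G'_def)
      then have "H i \<subset> H (Suc i) \<inter> B"
        using Suc by auto
      with Suc.prems N have "H (Suc i) \<inter> B = H (Suc i)"
        by (intro unrefinable_chain_step[OF H, of i]) auto
      then show ?case
        by blast
    qed
    from this[of l] have JB: "?J \<subseteq> B"
      using chain by (simp add: bimodule_chain_def)
    show "carrier A \<subseteq> B"
      unfolding decomp[symmetric] using SB JB B'(7) by (auto simp: set_add_def')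
  qed
  then have "generated_subalgebra K A G' = carrier A"
    using G'c by (intro generated_subalgebra_eqI)
  moreover have "card G' \<le> card G + l"
  proof -
    have "card G' \<le> card G + card (x ` {..<l})"
      unfolding G'_def by (rule card_Un_le)
    also have "card (x ` {..<l}) \<le> l"
      using card_image_le[of "{..<l}" x] by simp
    finally show ?thesis
      by simp
  qed
  moreover have "finite G'"
    using G(2) by (simp add: G'_def)
  ultimately show ?thesis
    using G'c l by blast
qed

section \<open>Generating the semisimple part\<close>

text \<open>A splitting with a fixed isomorphism \<phi>: \<open>\<phi> s i j\<close> is the
  coordinate of \<open>s\<close> in the \<open>j\<close>-th copy of the \<open>i\<close>-th matrix
  algebra.\<close>

locale split_algebra = assoc_algebra K A
  for K :: "('k, 'u) ring_scheme" (structure) and A :: "('k, 'a, 'v) module_scheme" (structure) +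
  fixes L :: "nat \<Rightarrow> ('k, 'l, 'w) module_scheme" and S :: "'a set" and q r :: nat
    and \<alpha> m n :: "nat \<Rightarrow> nat" and \<phi> :: "'a \<Rightarrow> nat \<Rightarrow> nat \<Rightarrow> nat \<times> nat \<Rightarrow> 'l"
  assumes finite_algebra: "finite_algebra K A"
    and q: "q = order K"
    and S: "unital_subalgebra K S A"
    and disjoint: "S \<inter> jacobson_radical A = {\<zero>\<^bsub>A\<^esub>}"
    and decomp: "S <+>\<^bsub>A\<^esub> jacobson_radical A = carrier A"
    and pos: "\<And>i. i \<in> {1..r} \<Longrightarrow> \<alpha> i \<ge> 1 \<and> m i \<ge> 1 \<and> n i \<ge> 1"
    and L: "\<And>i. i \<in> {1..r} \<Longrightarrow> field (L i) \<and> order (L i) = q ^ m i"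
    and not_iso: "\<And>i j. \<lbrakk>i \<in> {1..r}; j \<in> {1..r}; i \<noteq> j\<rbrakk> \<Longrightarrow>
      \<not> alg_isomorphic K (matrix_alg (n i) (L i)) (matrix_alg (n j) (L j))"
    and \<phi>: "\<phi> \<in> alg_iso K (A\<lparr>carrier := S\<rparr>)
      (product_alg {1..r} (\<lambda>i. product_alg {1..\<alpha> i} (\<lambda>_. matrix_alg (n i) (L i))))"
begin

abbreviation "T i \<equiv> matrix_alg (n i) (L i)"

lemma q_ge_2: "q \<ge> 2"
proof -
  interpret K: finite_algebra K A
    by (rule finite_algebra)
  have "card {\<zero>, \<one>} \<le> card (carrier K)"
    using K.finite_scalars by (intro card_mono) auto
  then show ?thesis
    using K.one_not_zero by (simp add: q order_def)
qed

lemma matrix_field: "i \<in> {1..r} \<Longrightarrow> matrix_field (L i)"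
  using L by (simp add: matrix_field_def)

lemma finite_L: "i \<in> {1..r} \<Longrightarrow> finite (carrier (L i))"
  using L[of i] q_ge_2 by (auto simp: order_def intro!: card_ge_0_finite)

lemma finite_T: "i \<in> {1..r} \<Longrightarrow> finite (carrier (T i))"
  using finite_L by (auto simp: matrix_alg_def intro!: finite_PiE)

lemma card_T: "i \<in> {1..r} \<Longrightarrow> card (carrier (T i)) = q ^ (m i * (n i)\<^sup>2)"
  using L[of i] by (simp add: matrix_alg_def card_PiE order_def power_mult power2_eq_square)

lemma ring_T: "i \<in> {1..r} \<Longrightarrow> ring (T i)"
  using matrix_field by (intro matrix_ring.mat_ring) (simp add: matrix_field_def matrix_ring_def field.is_ring)

lemma S_subset: "S \<subseteq> carrier A"
  using S by (auto simp: unital_subalgebra_def dest: subringE(1))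

section \<open>Coordinates of elements of the semisimple part\<close>

lemma comp_closed: "\<lbrakk>s \<in> S; i \<in> {1..r}; j \<in> {1..\<alpha> i}\<rbrakk> \<Longrightarrow> \<phi> s i j \<in> carrier (T i)"
  and comp_mult: "\<lbrakk>s \<in> S; t \<in> S; i \<in> {1..r}; j \<in> {1..\<alpha> i}\<rbrakk>
    \<Longrightarrow> \<phi> (s \<otimes>\<^bsub>A\<^esub> t) i j = \<phi> s i j \<otimes>\<^bsub>T i\<^esub> \<phi> t i j"
  and comp_add: "\<lbrakk>s \<in> S; t \<in> S; i \<in> {1..r}; j \<in> {1..\<alpha> i}\<rbrakk>
    \<Longrightarrow> \<phi> (s \<oplus>\<^bsub>A\<^esub> t) i j = \<phi> s i j \<oplus>\<^bsub>T i\<^esub> \<phi> t i j"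
  and comp_one: "\<lbrakk>i \<in> {1..r}; j \<in> {1..\<alpha> i}\<rbrakk> \<Longrightarrow> \<phi> \<one>\<^bsub>A\<^esub> i j = \<one>\<^bsub>T i\<^esub>"
  and comp_smult: "\<lbrakk>a \<in> carrier K; s \<in> S; i \<in> {1..r}; j \<in> {1..\<alpha> i}\<rbrakk>
    \<Longrightarrow> \<phi> (a \<odot>\<^bsub>A\<^esub> s) i j = a \<odot>\<^bsub>T i\<^esub> \<phi> s i j"
proof -
  let ?P = "product_alg {1..r} (\<lambda>i. product_alg {1..\<alpha> i} (\<lambda>_. T i))"
  have hom: "\<phi> \<in> ring_hom (A\<lparr>carrier := S\<rparr>) ?P"
    and sm: "\<And>a s. \<lbrakk>a \<in> carrier K; s \<in> S\<rbrakk> \<Longrightarrow> \<phi> (a \<odot>\<^bsub>A\<^esub> s) = a \<odot>\<^bsub>?P\<^esub> \<phi> s"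
    using \<phi> by (auto simp: alg_iso_def ring_iso_def)
  note hom' = ring_hom_memE[OF hom, simplified]
  show "\<phi> s i j \<in> carrier (T i)" if "s \<in> S" "i \<in> {1..r}" "j \<in> {1..\<alpha> i}"
    using hom'(1)[OF that(1)] that(2,3) unfolding product_alg_def by (auto simp: PiE_iff)
  show "\<phi> (s \<otimes>\<^bsub>A\<^esub> t) i j = \<phi> s i j \<otimes>\<^bsub>T i\<^esub> \<phi> t i j"
    if "s \<in> S" "t \<in> S" "i \<in> {1..r}" "j \<in> {1..\<alpha> i}"
    unfolding hom'(2)[OF that(1,2)] using that(3,4) by (simp add: product_alg_def)
  show "\<phi> (s \<oplus>\<^bsub>A\<^esub> t) i j = \<phi> s i j \<oplus>\<^bsub>T i\<^esub> \<phi> t i j"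
    if "s \<in> S" "t \<in> S" "i \<in> {1..r}" "j \<in> {1..\<alpha> i}"
    unfolding hom'(3)[OF that(1,2)] using that(3,4) by (simp add: product_alg_def)
  show "\<phi> \<one>\<^bsub>A\<^esub> i j = \<one>\<^bsub>T i\<^esub>" if "i \<in> {1..r}" "j \<in> {1..\<alpha> i}"
    unfolding hom'(4) using that by (simp add: product_alg_def)
  show "\<phi> (a \<odot>\<^bsub>A\<^esub> s) i j = a \<odot>\<^bsub>T i\<^esub> \<phi> s i j"
    if "a \<in> carrier K" "s \<in> S" "i \<in> {1..r}" "j \<in> {1..\<alpha> i}"
    unfolding sm[OF that(1,2)] using that(3,4) by (simp add: product_alg_def)
qed

lemma comp_eqI:
  assumes "s \<in> S" "t \<in> S" "\<And>i j. \<lbrakk>i \<in> {1..r}; j \<in> {1..\<alpha> i}\<rbrakk> \<Longrightarrow> \<phi> s i j = \<phi> t i j"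
  shows "s = t"
proof -
  let ?P = "product_alg {1..r} (\<lambda>i. product_alg {1..\<alpha> i} (\<lambda>_. T i))"
  have bij: "bij_betw \<phi> S (carrier ?P)"
    using \<phi> by (auto simp: alg_iso_def ring_iso_def)
  then have mem: "\<phi> s \<in> carrier ?P" "\<phi> t \<in> carrier ?P"
    using assms(1,2) by (auto simp: bij_betw_def)
  have "\<phi> s = \<phi> t"
  proof (rule PiE_ext)
    show "\<phi> s \<in> (\<Pi>\<^sub>E i\<in>{1..r}. {1..\<alpha> i} \<rightarrow>\<^sub>E carrier (T i))"
      "\<phi> t \<in> (\<Pi>\<^sub>E i\<in>{1..r}. {1..\<alpha> i} \<rightarrow>\<^sub>E carrier (T i))"
      using mem by (simp_all add: product_alg_def)
    then have "\<phi> s i \<in> {1..\<alpha> i} \<rightarrow>\<^sub>E carrier (T i)" "\<phi> t i \<in> {1..\<alpha> i} \<rightarrow>\<^sub>E carrier (T i)"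
      if "i \<in> {1..r}" for i
      using that by (blast dest: PiE_mem)+
    from PiE_ext[OF this] show "\<phi> s i = \<phi> t i" if "i \<in> {1..r}" for i
      using that assms(3) by blast
  qed
  with bij assms(1,2) show ?thesis
    by (auto simp: bij_betw_def dest: inj_onD)
qed

lemma comp_surj:
  assumes "\<And>i j. \<lbrakk>i \<in> {1..r}; j \<in> {1..\<alpha> i}\<rbrakk> \<Longrightarrow> y i j \<in> carrier (T i)"
  shows "\<exists>s\<in>S. \<forall>i\<in>{1..r}. \<forall>j\<in>{1..\<alpha> i}. \<phi> s i j = y i j"
proof -
  let ?P = "product_alg {1..r} (\<lambda>i. product_alg {1..\<alpha> i} (\<lambda>_. T i))"
  have "(\<lambda>i\<in>{1..r}. \<lambda>j\<in>{1..\<alpha> i}. y i j) \<in> carrier ?P"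
    using assms by (auto simp: product_alg_def)
  moreover have "\<phi> ` S = carrier ?P"
    using \<phi> by (auto simp: alg_iso_def ring_iso_def bij_betw_def)
  ultimately have "(\<lambda>i\<in>{1..r}. \<lambda>j\<in>{1..\<alpha> i}. y i j) \<in> \<phi> ` S"
    by (simp only:)
  then obtain s where "s \<in> S" "\<phi> s = (\<lambda>i\<in>{1..r}. \<lambda>j\<in>{1..\<alpha> i}. y i j)"
    by (rule imageE) simp
  then show ?thesis
    by (intro bexI[of _ s]) auto
qed

text \<open>Stated for subalgebras \<open>C\<close> of \<open>S\<close>, since the separation of
  coordinates is carried out inside the part of \<open>S\<close> that the generators reach.\<close>

lemma comp_ring_hom:
  assumes "unital_subalgebra K C A" "C \<subseteq> S" "i \<in> {1..r}" "j \<in> {1..\<alpha> i}"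
  shows "ring_hom_ring (A\<lparr>carrier := C\<rparr>) (T i) (\<lambda>s. \<phi> s i j)"
proof (rule ring_hom_ringI2)
  show "ring (A\<lparr>carrier := C\<rparr>)"
    using assms(1) by (auto simp: unital_subalgebra_def intro: subring_is_ring)
  show "(\<lambda>s. \<phi> s i j) \<in> ring_hom (A\<lparr>carrier := C\<rparr>) (T i)"
    using assms comp_closed comp_mult comp_add comp_one
    by (intro ring_hom_memI) (auto dest!: subsetD[OF assms(2)])
qed (rule ring_T[OF assms(3)])

text \<open>The negative here is taken in \<open>A\<close>, not in the restricted structure on
  \<open>S\<close>, so it is identified through the uniqueness of additive inverses in
  \<open>T i\<close>.\<close>

lemma comp_minus:
  assumes "s \<in> S" "i \<in> {1..r}" "j \<in> {1..\<alpha> i}"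
  shows "\<phi> (\<ominus>\<^bsub>A\<^esub> s) i j = \<ominus>\<^bsub>T i\<^esub> \<phi> s i j"
proof -
  interpret c: ring_hom_ring "A\<lparr>carrier := S\<rparr>" "T i" "\<lambda>s. \<phi> s i j"
    by (rule comp_ring_hom[OF S subset_refl assms(2,3)])
  have ms: "\<ominus>\<^bsub>A\<^esub> s \<in> S"
    using S assms(1) by (auto simp: unital_subalgebra_def dest: subringE(5))
  have "\<phi> (\<ominus>\<^bsub>A\<^esub> s) i j \<oplus>\<^bsub>T i\<^esub> \<phi> s i j = \<phi> (\<ominus>\<^bsub>A\<^esub> s \<oplus>\<^bsub>A\<^esub> s) i j"
    using comp_add[OF ms assms] by simp
  also have "\<dots> = \<zero>\<^bsub>T i\<^esub>"
    using c.hom_zero assms(1) S_subset by (simp add: l_neg subset_eq)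
  finally show ?thesis
    using comp_closed[OF assms] comp_closed[OF ms assms(2,3)] by (rule c.S.minus_equality[symmetric])
qed

text \<open>If two of the \<open>\<alpha> i\<close> copies of \<open>T i\<close> received the same coordinates of the generators, then
  the elements of \<open>A\<close> with equal coordinates in both copies would form a proper subalgebra
  containing the generators.\<close>

lemma multiplicity_le:
  assumes i: "i \<in> {1..r}"
    and G: "G \<subseteq> carrier A" "finite G" "generated_subalgebra K A G = carrier A"
  shows "\<alpha> i \<le> q ^ (m i * (n i)\<^sup>2 * card G)"
proof -
  let ?J = "jacobson_radical A"
  interpret J: ideal ?J A
    by (rule jacobson_radical_ideal)
  have Sc: "s \<in> carrier A" if "s \<in> S" for s
    using that S_subset by blast
  have "\<exists>s\<in>S. \<exists>x\<in>?J. g = s \<oplus>\<^bsub>A\<^esub> x" if "g \<in> G" for g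
  proof -
    have "g \<in> S <+>\<^bsub>A\<^esub> ?J"
      using that G(1) decomp by blast
    then show ?thesis
      by (auto simp: set_add_def')
  qed
  then obtain \<sigma> where \<sigma>: "\<And>g. g \<in> G \<Longrightarrow> \<sigma> g \<in> S" "\<And>g. g \<in> G \<Longrightarrow> \<exists>x\<in>?J. g = \<sigma> g \<oplus>\<^bsub>A\<^esub> x"
    by metis
  \<comment> \<open>\<open>t j\<close> collects the \<open>j\<close>-th coordinates of the
    semisimple parts of the generators. Injectivity of \<open>t\<close> bounds
    \<open>\<alpha> i\<close> by the number of such tuples.\<close>
  define t where "t j = (\<lambda>g\<in>G. \<phi> (\<sigma> g) i j)" for j
  have "inj_on t {1..\<alpha> i}"
  proof (rule inj_onI, rule ccontr)
    fix j j' assume j: "j \<in> {1..\<alpha> i}" "j' \<in> {1..\<alpha> i}" "t j = t j'" "j \<noteq> j'"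
    interpret c: ring_hom_ring "A\<lparr>carrier := S\<rparr>" "T i" "\<lambda>s. \<phi> s i j"
      by (rule comp_ring_hom[OF S subset_refl i j(1)])
    interpret c': ring_hom_ring "A\<lparr>carrier := S\<rparr>" "T i" "\<lambda>s. \<phi> s i j'"
      by (rule comp_ring_hom[OF S subset_refl i j(2)])
    define D where "D = {s \<in> S. \<phi> s i j = \<phi> s i j'}"
    have sub: "subring S A" and sm: "\<And>a x. \<lbrakk>a \<in> carrier K; x \<in> S\<rbrakk> \<Longrightarrow> a \<odot>\<^bsub>A\<^esub> x \<in> S"
      using S by (auto simp: unital_subalgebra_def)
    note S' = subringE[OF sub]
    have "unital_subalgebra K D A"
      unfolding unital_subalgebra_def
    proof (intro conjI ballI subringI)
      fix s assume "s \<in> D"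
      then show "\<ominus>\<^bsub>A\<^esub> s \<in> D"
        using S'(5) comp_minus[OF _ i j(1)] comp_minus[OF _ i j(2)] by (simp add: D_def)
    qed (use i j S' Sc sm comp_mult comp_add comp_one comp_smult in \<open>auto simp: D_def\<close>)
    \<comment> \<open>The semisimple parts of the generators lie in \<open>D\<close>, the generators
      themselves only in \<open>D\<close> plus the radical.\<close>
    then have "unital_subalgebra K (D <+>\<^bsub>A\<^esub> ?J) A"
      using jacobson_radical_ideal by (rule unital_subalgebra_add_ideal)
    moreover have "G \<subseteq> D <+>\<^bsub>A\<^esub> ?J"
    proof
      fix g assume g: "g \<in> G"
      then have "t j g = t j' g"
        using j(3) by simp
      with g \<sigma>(1) have "\<sigma> g \<in> D"
        by (simp add: t_def D_def)
      with \<sigma>(2)[OF g] show "g \<in> D <+>\<^bsub>A\<^esub> ?J"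
        by (auto simp: set_add_def')
    qed
    ultimately have A: "carrier A \<subseteq> D <+>\<^bsub>A\<^esub> ?J"
      unfolding G(3)[symmetric] by (auto simp: generated_subalgebra_def)
    have "(if k = j then \<one>\<^bsub>T i'\<^esub> else \<zero>\<^bsub>T i'\<^esub>) \<in> carrier (T i')" if "i' \<in> {1..r}" for i' k
      using ring_T[OF that] by (auto intro: ring.ring_simprules)
    \<comment> \<open>An element of \<open>S\<close> that is one in copy \<open>j\<close> and zero
      in copy \<open>j'\<close> refutes \<open>D + J = A\<close>, because \<open>S\<close> meets the
      radical trivially.\<close>
    from comp_surj[of "\<lambda>i' k. if k = j then \<one>\<^bsub>T i'\<^esub> else \<zero>\<^bsub>T i'\<^esub>", OF this]
    obtain s where s: "s \<in> S" "\<phi> s i j = \<one>\<^bsub>T i\<^esub>" "\<phi> s i j' = \<zero>\<^bsub>T i\<^esub>"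
      using i j by (metis (full_types))
    obtain d x where d: "d \<in> D" "x \<in> ?J" "s = d \<oplus>\<^bsub>A\<^esub> x"
      using subsetD[OF A Sc[OF s(1)]] by (auto simp: set_add_def')
    have dS: "d \<in> S"
      using d(1) by (simp add: D_def)
    have "\<ominus>\<^bsub>A\<^esub> d \<oplus>\<^bsub>A\<^esub> s = x"
      using d Sc[OF dS] J.a_Hcarr by (simp add: a_assoc[symmetric] l_neg)
    then have "x \<in> S \<inter> ?J"
      using d(2) S'(5,7) dS s(1) by blast
    then have "s = d"
      using disjoint d(3) Sc[OF dS] by simp
    with d(1) s have "\<one>\<^bsub>T i\<^esub> = \<zero>\<^bsub>T i\<^esub>"
      by (simp add: D_def)
    moreover have "\<one>\<^bsub>T i\<^esub> \<noteq> \<zero>\<^bsub>T i\<^esub>"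
      using matrix_field.mat_one_neq_zero[OF matrix_field[OF i]] pos[OF i] by blast
    ultimately show False
      by blast
  qed
  moreover have "t ` {1..\<alpha> i} \<subseteq> G \<rightarrow>\<^sub>E carrier (T i)"
    using \<sigma>(1) comp_closed i by (auto simp: t_def)
  moreover have "finite (G \<rightarrow>\<^sub>E carrier (T i))"
    using G(2) finite_T[OF i] by (intro finite_PiE)
  ultimately have "card {1..\<alpha> i} \<le> card (G \<rightarrow>\<^sub>E carrier (T i))"
    by (rule card_inj_on_le)
  then show ?thesis
    using G(2) by (simp add: card_PiE card_T[OF i] power_mult)
qed

section \<open>Generators of the semisimple part\<close>

text \<open>Two elements \<open>u\<close>, \<open>v\<close> make every coordinate projection
  surjective, and \<open>d\<close> elements \<open>w k\<close> tell the copies of the same matrix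
  algebra apart; different \<open>i\<close> are told apart by non-isomorphism.\<close>

lemma semisimple_part_generators:
  assumes d: "\<And>i. i \<in> {1..r} \<Longrightarrow> \<alpha> i \<le> q ^ (m i * (n i)\<^sup>2 * d)"
  shows "\<exists>G \<subseteq> S. finite G \<and> card G \<le> d + 2 \<and> (\<forall>B. unital_subalgebra K B A \<and> G \<subseteq> B \<longrightarrow> S \<subseteq> B)"
proof -
  have "\<exists>\<theta>. \<theta> \<in> carrier (L i) \<and> carrier (L i) - {\<zero>\<^bsub>L i\<^esub>} \<subseteq> range (\<lambda>k. \<theta> [^]\<^bsub>L i\<^esub> Suc k)"
    if "i \<in> {1..r}" for i
    using field.finite_field_powers[OF _ finite_L[OF that]] L[OF that] by metis
  then obtain \<theta> where \<theta>: "\<And>i. i \<in> {1..r} \<Longrightarrow> \<theta> i \<in> carrier (L i)"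
      "\<And>i. i \<in> {1..r} \<Longrightarrow> carrier (L i) - {\<zero>\<^bsub>L i\<^esub>} \<subseteq> range (\<lambda>k. \<theta> i [^]\<^bsub>L i\<^esub> Suc k)"
    by metis
  \<comment> \<open>By the hypothesis there are at least \<open>\<alpha> i\<close> tuples of length
    \<open>d\<close> over \<open>T i\<close>, so the copies can be labelled by distinct tuples
    \<open>X i j\<close>; their entries become the coordinates of the \<open>w k\<close>.\<close>
  have "\<exists>X. X ` {1..\<alpha> i} \<subseteq> ({..<d} \<rightarrow>\<^sub>E carrier (T i)) \<and> inj_on X {1..\<alpha> i}" if i: "i \<in> {1..r}" for i
  proof (rule card_le_inj)
    show "finite ({..<d} \<rightarrow>\<^sub>E carrier (T i))"
      using finite_T[OF i] by (intro finite_PiE) auto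
    show "card {1..\<alpha> i} \<le> card ({..<d} \<rightarrow>\<^sub>E carrier (T i))"
      using d[OF i] by (simp add: card_PiE card_T[OF i] power_mult)
  qed simp
  then obtain X where X: "\<And>i. i \<in> {1..r} \<Longrightarrow> X i ` {1..\<alpha> i} \<subseteq> ({..<d} \<rightarrow>\<^sub>E carrier (T i))"
      "\<And>i. i \<in> {1..r} \<Longrightarrow> inj_on (X i) {1..\<alpha> i}"
    by metis
  have mr: "matrix_ring (L i)" if "i \<in> {1..r}" for i
    using L[OF that] by (simp add: matrix_ring_def field.is_ring)
  obtain u where u: "u \<in> S"
      "\<And>i j. \<lbrakk>i \<in> {1..r}; j \<in> {1..\<alpha> i}\<rbrakk> \<Longrightarrow> \<phi> u i j = matrix_ring.elem_mat (L i) (n i) 0 0 (\<theta> i)"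
    using comp_surj[of "\<lambda>i j. matrix_ring.elem_mat (L i) (n i) 0 0 (\<theta> i)"]
      \<theta>(1) mr matrix_ring.elem_mat_closed by metis
  obtain v where v: "v \<in> S"
      "\<And>i j. \<lbrakk>i \<in> {1..r}; j \<in> {1..\<alpha> i}\<rbrakk> \<Longrightarrow> \<phi> v i j = matrix_ring.cyclic_mat (L i) (n i)"
    using comp_surj[of "\<lambda>i j. matrix_ring.cyclic_mat (L i) (n i)"]
      mr matrix_ring.cyclic_mat_closed by metis
  have "\<exists>s\<in>S. \<forall>i\<in>{1..r}. \<forall>j\<in>{1..\<alpha> i}. \<phi> s i j = X i j k" if "k < d" for k
    using X(1) that by (intro comp_surj) blast
  then obtain w where w: "\<And>k. k < d \<Longrightarrow> w k \<in> S"
      "\<And>k i j. \<lbrakk>k < d; i \<in> {1..r}; j \<in> {1..\<alpha> i}\<rbrakk> \<Longrightarrow> \<phi> (w k) i j = X i j k"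
    by metis
  define G where "G = insert u (insert v (w ` {..<d}))"
  have "S \<subseteq> B" if B: "unital_subalgebra K B A" "G \<subseteq> B" for B
  proof -
    \<comment> \<open>The coordinates are controlled only on \<open>S\<close>, so the argument runs
      in \<open>B \<inter> S\<close>.\<close>
    define C where "C = B \<inter> S"
    have C: "unital_subalgebra K C A" "C \<subseteq> S"
      using unital_subalgebra_Int[OF B(1) S] by (auto simp: C_def)
    have subC: "subring C A" and smC: "\<And>a x. \<lbrakk>a \<in> carrier K; x \<in> C\<rbrakk> \<Longrightarrow> a \<odot>\<^bsub>A\<^esub> x \<in> C"
      using C(1) by (auto simp: unital_subalgebra_def)
    interpret C: ring "A\<lparr>carrier := C\<rparr>"
      using subC by (rule subring_is_ring)
    have GC: "u \<in> C" "v \<in> C" "\<And>k. k < d \<Longrightarrow> w k \<in> C"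
      using B(2) u(1) v(1) w(1) by (auto simp: C_def G_def)
    have onto: "(\<lambda>s. \<phi> s i j) ` E = carrier (T i)"
      if ij: "i \<in> {1..r}" "j \<in> {1..\<alpha> i}" and E: "subring E (A\<lparr>carrier := C\<rparr>)" "u \<in> E" "v \<in> E" for i j E
    proof (rule matrix_field.mat_two_generated[OF matrix_field[OF ij(1)] _ _ \<theta>[OF ij(1)]])
      show "subring ((\<lambda>s. \<phi> s i j) ` E) (T i)"
        using comp_ring_hom[OF C ij] E(1) by (rule ring_hom_ring.img_is_subring)
      show "n i \<ge> 1"
        using pos ij by blast
      show "matrix_ring.elem_mat (L i) (n i) 0 0 (\<theta> i) \<in> (\<lambda>s. \<phi> s i j) ` E"
        using u(2)[OF ij] E(2) by (metis imageI)
      show "matrix_ring.cyclic_mat (L i) (n i) \<in> (\<lambda>s. \<phi> s i j) ` E"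
        using v(2)[OF ij] E(3) by (metis imageI)
    qed
    have ontoC: "(\<lambda>s. \<phi> s i j) ` C = carrier (T i)" if "i \<in> {1..r}" "j \<in> {1..\<alpha> i}" for i j
      using onto[OF that, of C] C.carrier_is_subring GC by simp
    have sep: "\<exists>x\<in>C. \<phi> x i j = \<zero>\<^bsub>T i\<^esub> \<and> \<phi> x i' j' \<noteq> \<zero>\<^bsub>T i'\<^esub>"
      if ij: "i \<in> {1..r}" "j \<in> {1..\<alpha> i}" "i' \<in> {1..r}" "j' \<in> {1..\<alpha> i'}" "(i, j) \<noteq> (i', j')"
      for i j i' j'
    proof (rule ccontr)
      assume "\<not> ?thesis"
      then have ker: "\<phi> x i' j' = \<zero>\<^bsub>T i'\<^esub>" if "x \<in> C" "\<phi> x i j = \<zero>\<^bsub>T i\<^esub>" for x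
        using that by blast
      interpret c: ring_hom_ring "A\<lparr>carrier := C\<rparr>" "T i" "\<lambda>s. \<phi> s i j"
        by (rule comp_ring_hom[OF C ij(1,2)])
      interpret c': ring_hom_ring "A\<lparr>carrier := C\<rparr>" "T i'" "\<lambda>s. \<phi> s i' j'"
        by (rule comp_ring_hom[OF C ij(3,4)])
      \<comment> \<open>If no element separates the two coordinates, one coordinate determines the
        other on \<open>C\<close> through a ring isomorphism.\<close>
      have "\<exists>\<psi>\<in>ring_iso (T i) (T i'). \<forall>x\<in>carrier (A\<lparr>carrier := C\<rparr>). \<psi> (\<phi> x i j) = \<phi> x i' j'"
      proof (rule C.iso_of_kernel_subset[where h = "\<lambda>s. \<phi> s i j" and h' = "\<lambda>s. \<phi> s i' j'"])
        show "\<one>\<^bsub>T i'\<^esub> \<noteq> \<zero>\<^bsub>T i'\<^esub>"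
          using matrix_field.mat_one_neq_zero[OF matrix_field[OF ij(3)]] pos[OF ij(3)] by blast
        show "J = {\<zero>\<^bsub>T i\<^esub>} \<or> J = carrier (T i)" if "ideal J (T i)" for J
          using matrix_field[OF ij(1)] that by (rule matrix_field.mat_simple)
      qed (use ontoC ij ker c.ring_hom_ring_axioms c'.ring_hom_ring_axioms in simp_all)
      then obtain \<psi> where \<psi>: "\<psi> \<in> ring_iso (T i) (T i')" "\<And>x. x \<in> C \<Longrightarrow> \<psi> (\<phi> x i j) = \<phi> x i' j'"
        by auto
      show False
      proof (cases "i = i'")
        case False
        \<comment> \<open>For different \<open>i\<close>, \<psi> is linear over the scalars because
          \<open>C\<close> is stable under them, which contradicts \<open>not_iso\<close>.\<close>
        have "\<psi> (a \<odot>\<^bsub>T i\<^esub> y) = a \<odot>\<^bsub>T i'\<^esub> \<psi> y" if a: "a \<in> carrier K" and y: "y \<in> carrier (T i)" for a y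
        proof -
          obtain x where x: "x \<in> C" "y = \<phi> x i j"
            using y ontoC[OF ij(1,2)] by blast
          have "x \<in> S"
            using x(1) C(2) by blast
          have "\<psi> (a \<odot>\<^bsub>T i\<^esub> y) = \<psi> (\<phi> (a \<odot>\<^bsub>A\<^esub> x) i j)"
            using comp_smult[OF a \<open>x \<in> S\<close> ij(1,2)] x(2) by simp
          also have "\<dots> = a \<odot>\<^bsub>T i'\<^esub> \<psi> y"
            using \<psi>(2)[OF smC[OF a x(1)]] \<psi>(2)[OF x(1)] comp_smult[OF a \<open>x \<in> S\<close> ij(3,4)] x(2) by simp
          finally show ?thesis .
        qed
        with \<psi>(1) have "\<psi> \<in> alg_iso K (T i) (T i')"
          by (simp add: alg_iso_def)
        then show False
          using not_iso[OF ij(1,3) False] by (auto simp: alg_isomorphic_def)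
      next
        case True
        have ij': "j' \<in> {1..\<alpha> i}"
          using ij(4) True by simp
        interpret c': ring_hom_ring "A\<lparr>carrier := C\<rparr>" "T i" "\<lambda>s. \<phi> s i j'"
          by (rule comp_ring_hom[OF C ij(1) ij'])
        have \<psi>_hom: "\<psi> \<in> ring_hom (T i) (T i)"
          using \<psi>(1) True by (simp add: ring_iso_def)
        interpret \<psi>: ring_hom_ring "T i" "T i" \<psi>
          using c.S.ring_axioms c.S.ring_axioms \<psi>_hom by (rule ring_hom_ringI2)
        have \<psi>': "\<psi> (\<phi> x i j) = \<phi> x i j'" if "x \<in> C" for x
          using \<psi>(2)[OF that] True by simp
        \<comment> \<open>For two copies of the same \<open>T i\<close>, \<psi> fixes the
          coordinates of \<open>u\<close> and \<open>v\<close>, which agree in all copies. These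
          generate \<open>T i\<close>, so \<psi> is the identity and the labels of the two copies
          coincide.\<close>
        define H where "H = {y \<in> carrier (T i). \<psi> y = y}"
        have "subring H (T i)"
          by (rule c.S.subringI) (auto simp: H_def)
        moreover have "matrix_ring.elem_mat (L i) (n i) 0 0 (\<theta> i) \<in> H"
          using \<psi>'[OF GC(1)] u(2)[OF ij(1,2)] u(2)[OF ij(1) ij'] comp_closed[OF u(1) ij(1,2)]
          by (simp add: H_def)
        moreover have "matrix_ring.cyclic_mat (L i) (n i) \<in> H"
          using \<psi>'[OF GC(2)] v(2)[OF ij(1,2)] v(2)[OF ij(1) ij'] comp_closed[OF v(1) ij(1,2)]
          by (simp add: H_def)
        ultimately have H: "H = carrier (T i)"
          using matrix_field.mat_two_generated[OF matrix_field[OF ij(1)] _ _ \<theta>[OF ij(1)]] pos[OF ij(1)]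
          by blast
        have "X i j k = X i j' k" if "k < d" for k
        proof -
          have "\<phi> (w k) i j \<in> H"
            using comp_closed[OF w(1)[OF that] ij(1,2)] by (simp add: H)
          then show ?thesis
            using \<psi>'[OF GC(3)[OF that]] w(2)[OF that ij(1,2)] w(2)[OF that ij(1) ij'] by (simp add: H_def)
        qed
        moreover have "X i j \<in> {..<d} \<rightarrow>\<^sub>E carrier (T i)" "X i j' \<in> {..<d} \<rightarrow>\<^sub>E carrier (T i)"
          using X(1)[OF ij(1)] ij(2) ij' by blast+
        ultimately have "X i j = X i j'"
          by (intro PiE_ext) auto
        then have "j = j'"
          using inj_onD[OF X(2)[OF ij(1)]] ij(2) ij' by blast
        with True ij(5) show False
          by simp
      qed
    qed
    show "S \<subseteq> B"
    proof
      fix s assume s: "s \<in> S"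
      let ?I = "SIGMA i:{1..r}. {1..\<alpha> i}"
      \<comment> \<open>The Chinese remainder theorem over all pairs \<open>(i, j)\<close> produces
        an element of \<open>C\<close> with the coordinates of \<open>s\<close>, which must be
        \<open>s\<close>.\<close>
      have "\<exists>x\<in>carrier (A\<lparr>carrier := C\<rparr>). \<forall>p\<in>?I. \<phi> x (fst p) (snd p) = \<phi> s (fst p) (snd p)"
      proof (rule C.chinese_remainder_simple[where T = "\<lambda>p. T (fst p)"])
        fix p assume p: "p \<in> ?I"
        then have p': "fst p \<in> {1..r}" "snd p \<in> {1..\<alpha> (fst p)}"
          by auto
        show "ring_hom_ring (A\<lparr>carrier := C\<rparr>) (T (fst p)) (\<lambda>x. \<phi> x (fst p) (snd p))"
          using C p' by (rule comp_ring_hom)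
        show "(\<lambda>x. \<phi> x (fst p) (snd p)) ` carrier (A\<lparr>carrier := C\<rparr>) = carrier (T (fst p))"
          using ontoC[OF p'] by simp
        show "\<phi> s (fst p) (snd p) \<in> carrier (T (fst p))"
          using s p' by (rule comp_closed)
        show "J = {\<zero>\<^bsub>T (fst p)\<^esub>} \<or> J = carrier (T (fst p))" if "ideal J (T (fst p))" for J
          using matrix_field[OF p'(1)] that by (rule matrix_field.mat_simple)
        fix p' assume "p' \<in> ?I" "p \<noteq> p'"
        then show "\<exists>x\<in>carrier (A\<lparr>carrier := C\<rparr>). \<phi> x (fst p) (snd p) = \<zero>\<^bsub>T (fst p)\<^esub>
            \<and> \<phi> x (fst p') (snd p') \<noteq> \<zero>\<^bsub>T (fst p')\<^esub>"
          using sep[OF p', of "fst p'" "snd p'"] by (auto simp: prod_eq_iff)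
      qed simp
      then obtain x where x: "x \<in> C" "\<forall>p\<in>?I. \<phi> x (fst p) (snd p) = \<phi> s (fst p) (snd p)"
        by auto
      then have "x = s"
        using C(2) s by (intro comp_eqI) auto
      with x(1) show "s \<in> B"
        by (simp add: C_def)
    qed
  qed
  moreover have "card G \<le> d + 2"
  proof -
    have "card G \<le> Suc (Suc (card (w ` {..<d})))"
      by (simp add: G_def card_insert_if)
    also have "card (w ` {..<d}) \<le> d"
      using card_image_le[of "{..<d}" w] by simp
    finally show ?thesis
      by simp
  qed
  moreover have "G \<subseteq> S" "finite G"
    using u(1) v(1) w(1) by (auto simp: G_def)
  ultimately show ?thesis
    by blast
qed

lemma generators_upper_bound:
  assumes "\<And>i. i \<in> {1..r} \<Longrightarrow> \<alpha> i \<le> q ^ (m i * (n i)\<^sup>2 * d)"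
  shows "\<exists>G \<subseteq> carrier A. finite G \<and> generated_subalgebra K A G = carrier A
    \<and> card G \<le> d + 2 + min_chain_length A S"
proof -
  obtain G where G: "G \<subseteq> S" "finite G" "card G \<le> d + 2"
      "\<And>B. \<lbrakk>unital_subalgebra K B A; G \<subseteq> B\<rbrakk> \<Longrightarrow> S \<subseteq> B"
    using semisimple_part_generators[OF assms] by metis
  obtain G' where "G' \<subseteq> carrier A" "finite G'" "generated_subalgebra K A G' = carrier A"
      "card G' \<le> card G + min_chain_length A S"
    using generators_along_chain[OF finite_algebra.finite_carrier[OF finite_algebra] S decomp G(1,2,4)]
    by metis
  with G(3) show ?thesis
    by (intro exI[of _ G']) auto
qed

end

section \<open>Bounds in terms of logarithms\<close>

text \<open>The factor \<open>m\<close> inside the logarithm is absorbed by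
  \<open>m < q ^ m\<close>, and \<open>q ^ m\<close> costs at most one more unit of \<open>d\<close>
  because \<open>n \<ge> 1\<close>.\<close>

lemma f_component_less:
  assumes "q \<ge> 2" "\<alpha> \<ge> 1" "m \<ge> 1" "n \<ge> 1" "\<alpha> \<le> q ^ (m * n\<^sup>2 * d)"
  shows "f_component q \<alpha> m n < real d + 1"
proof -
  have "m < q ^ m"
    using assms(1) by (intro power_gt_expt) auto
  then have "\<alpha> * m < q ^ (m * n\<^sup>2 * d) * q ^ m"
    using assms by (intro mult_le_less_imp_less) auto
  also have "\<dots> = q ^ (m * n\<^sup>2 * d + m)"
    by (simp add: power_add)
  also have "\<dots> \<le> q ^ (m * n\<^sup>2 * (d + 1))"
    using assms by (intro power_increasing) (auto simp: algebra_simps)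
  finally have "real (\<alpha> * m) < real (q ^ (m * n\<^sup>2 * (d + 1)))"
    by (simp only: of_nat_less_iff)
  then have "log (real q) (real \<alpha> * real m) < log (real q) (real q ^ (m * n\<^sup>2 * (d + 1)))"
    using assms by (subst log_less_cancel_iff) auto
  also have "\<dots> = (real d + 1) * (real m * (real n)\<^sup>2)"
    using assms by (simp add: log_nat_power algebra_simps)
  finally show ?thesis
    using assms unfolding f_component_def by (subst pos_divide_less_eq) auto
qed

text \<open>The hypothesis amounts to \<open>\<alpha> * m \<le> q ^ (m * n\<^sup>2 * d)\<close>, and
  \<open>\<alpha> \<le> \<alpha> * m\<close>.\<close>

lemma multiplicity_le_of_f_component:
  assumes "q \<ge> 2" "\<alpha> \<ge> 1" "m \<ge> 1" "n \<ge> 1" "f_component q \<alpha> m n \<le> real d"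
  shows "\<alpha> \<le> q ^ (m * n\<^sup>2 * d)"
proof -
  have "log (real q) (real \<alpha> * real m) \<le> real d * (real m * (real n)\<^sup>2)"
    using assms unfolding f_component_def by (subst (asm) pos_divide_le_eq) auto
  also have "\<dots> = log (real q) (real q ^ (m * n\<^sup>2 * d))"
    using assms by (simp add: log_nat_power algebra_simps)
  finally have "real \<alpha> * real m \<le> real q ^ (m * n\<^sup>2 * d)"
    using assms by (subst (asm) log_le_cancel_iff) auto
  then have "\<alpha> * m \<le> q ^ (m * n\<^sup>2 * d)"
    by (metis of_nat_le_iff of_nat_mult of_nat_power)
  moreover have "\<alpha> \<le> \<alpha> * m"
    using assms by simp
  ultimately show ?thesis
    by (rule order_trans[rotated])
qed

lemma f_component_nonneg:
  assumes "q \<ge> 2" "\<alpha> \<ge> 1" "m \<ge> 1"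
  shows "f_component q \<alpha> m n \<ge> 0"
proof -
  have "1 * 1 \<le> real \<alpha> * real m"
    using assms by (intro mult_mono) auto
  then have "log (real q) (real \<alpha> * real m) \<ge> 0"
    using assms by (subst zero_le_log_cancel_iff) auto
  then show ?thesis
    by (simp add: f_component_def)
qed

theorem theorem1p10:
  fixes K :: "('k, 'u) ring_scheme"
    and A :: "('k, 'a, 'v) module_scheme"
    and L :: "nat \<Rightarrow> ('k, 'l, 'w) module_scheme"
    and S :: "'a set"
    and q r :: nat
    and \<alpha> m n :: "nat \<Rightarrow> nat"
  assumes "finite_algebra K A"
    and "q = order K"
    and "unital_subalgebra K S A"
    and "S \<inter> jacobson_radical A = {\<zero>\<^bsub>A\<^esub>}"
    and "S <+>\<^bsub>A\<^esub> jacobson_radical A = carrier A"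
    and "r \<ge> 1"
    and "\<And>i. i \<in> {1..r} \<Longrightarrow> \<alpha> i \<ge> 1 \<and> m i \<ge> 1 \<and> n i \<ge> 1"
    and "\<And>i. i \<in> {1..r} \<Longrightarrow> assoc_algebra K (L i) \<and> field (L i) \<and> order (L i) = q ^ m i"
    and "\<And>i j. \<lbrakk>i \<in> {1..r}; j \<in> {1..r}; i \<noteq> j\<rbrakk> \<Longrightarrow>
      \<not> alg_isomorphic K (matrix_alg (n i) (L i)) (matrix_alg (n j) (L j))"
    and "alg_isomorphic K (A\<lparr>carrier := S\<rparr>)
      (product_alg {1..r} (\<lambda>i. product_alg {1..\<alpha> i} (\<lambda>_. matrix_alg (n i) (L i))))"
  shows "- 2.33 < real (min_generators K A) - (MAX i\<in>{1..r}. f_component q (\<alpha> i) (m i) (n i)) \<and>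
    real (min_generators K A) - (MAX i\<in>{1..r}. f_component q (\<alpha> i) (m i) (n i))
      < real (min_chain_length A S) + 3.42"
proof -
  obtain \<phi> where \<phi>: "\<phi> \<in> alg_iso K (A\<lparr>carrier := S\<rparr>)
      (product_alg {1..r} (\<lambda>i. product_alg {1..\<alpha> i} (\<lambda>_. matrix_alg (n i) (L i))))"
    using assms(10) by (auto simp: alg_isomorphic_def)
  interpret split_algebra K A L S q r \<alpha> m n \<phi>
    using assms(1-5,7-9) \<phi>
    by (intro split_algebra.intro split_algebra_axioms.intro) (auto simp: finite_algebra_def)
  let ?f = "\<lambda>i. f_component q (\<alpha> i) (m i) (n i)"
  define F where "F = Max (?f ` {1..r})"
  \<comment> \<open>The least natural number above \<open>F\<close>: since \<open>F\<close> is
    nonnegative, \<open>nat\<close> does not truncate, and rounding up loses less than 1.\<close>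
  define d where "d = nat \<lceil>F\<rceil>"
  have le_F: "?f i \<le> F" if "i \<in> {1..r}" for i
    unfolding F_def using that by (intro Max_ge) auto
  have "0 \<le> ?f 1"
    using q_ge_2 pos[of 1] assms(6) by (intro f_component_nonneg) auto
  also have "\<dots> \<le> F"
    using assms(6) by (intro le_F) auto
  finally have d: "F \<le> real d" "real d < F + 1"
    unfolding d_def by linarith+
  have "\<alpha> i \<le> q ^ (m i * (n i)\<^sup>2 * d)" if "i \<in> {1..r}" for i
    using q_ge_2 pos[OF that] le_F[OF that] d(1) by (intro multiplicity_le_of_f_component) auto
  then obtain G where G: "G \<subseteq> carrier A" "finite G" "generated_subalgebra K A G = carrier A"
      "card G \<le> d + 2 + min_chain_length A S"
    using generators_upper_bound by blast
  let ?P = "\<lambda>k. \<exists>G\<subseteq>carrier A. finite G \<and> card G = k \<and> generated_subalgebra K A G = carrier A"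
  have "?P (card G)"
    using G by blast
  then have min: "?P (min_generators K A)" "min_generators K A \<le> card G"
    unfolding min_generators_def by (rule LeastI, rule Least_le)
  \<comment> \<open>The 3 consists of the two elements \<open>u\<close>, \<open>v\<close> and the
    rounding loss; it lies below 3.42.\<close>
  have upper: "real (min_generators K A) < F + 3 + real (min_chain_length A S)"
    using min(2) G(4) d(2) by linarith
  obtain G' where G': "G' \<subseteq> carrier A" "finite G'" "card G' = min_generators K A"
      "generated_subalgebra K A G' = carrier A"
    using min(1) by blast
  \<comment> \<open>The multiplicity bound is applied to a generating set of minimal size; the
    resulting loss of 1 lies below 2.33.\<close>
  have "?f i < real (min_generators K A) + 1" if "i \<in> {1..r}" for i
    using q_ge_2 pos[OF that] multiplicity_le[OF that G'(1,2,4)] G'(3)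
    by (intro f_component_less) auto
  then have "F < real (min_generators K A) + 1"
    unfolding F_def using assms(6) by (subst Max_less_iff) simp_all
  with upper show ?thesis
    unfolding F_def by simp
qed

end
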